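(* Let $N\ge1$ and let $\lambda_1,\dots,\lambda_N$ (together with their complex conjugates) be the scaled eigenvalues of the quaternionic Ginibre ensemble, i.e. the eigenvalues of $\frac{1}{\sqrt{2N}}G$. Let $\mathbb{D}$ be the open unit disk and let $\mathscr{O}_{1,1}$ be the diagonal overlap associated to $\lambda_1$. Conditionally on $\Psi(\{\lambda_1,\dots,\lambda_N\})\in\mathbb{D}^{2N}$ (i.e. given the values of the eigenvalues, all in $\mathbb{D}$), the following identity in distribution holds: $$\mathscr{O}_{1,1}\stackrel{d}{=}\prod_{k=2}^N\left(1+\frac{|X_k|^2}{2N|\lambda_1-\lambda_k|^2}+\frac{|Y_k|^2}{2N|\lambda_1-\overline{\lambda_k}|^2}\right),$$ where $X_2,\dots,X_N,Y_2,\dots,Y_N$ are i.i.d. standard complex Gaussian variables (independent of the eigenvalues). In particular, $$\mathbb{E}\left(\mathscr{O}_{1,1}\,\middle|\,\Psi(\{\lambda_1,\dots,\lambda_N\})\right)=\prod_{k=2}^N\left(1+\frac{1}{2N|\lambda_1-\lambda_k|^2}+\frac{1}{2N|\lambda_1-\overline{\lambda_k}|^2}\right).$$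
   Context: $\mu$ denotes the standard complex Gaussian measure $d\mu(z)=\frac1\pi e^{-|z|^2}dm(z)$ on $\mathbb{C}$. For a finite set $A\subset\mathbb{C}$, $\Psi(A)=A\cup\bar A$. The unscaled quaternionic Ginibre matrix $G$ is the $2N\times 2N$ complex matrix made of $N^2$ independent $2\times2$ blocks $\begin{pmatrix} z&-\overline w\\ w&\overline z\end{pmatrix}$ with $z,w$ i.i.d. standard complex Gaussian. Its eigenvalues form $N$ complex conjugate pairs, and the representatives $(\lambda_1,\dots,\lambda_N)$ of these pairs are labelled so that, before scaling, their joint law is proportional to $\prod_{i<j}|\lambda_i-\lambda_j|^2\prod_{i\le j}|\lambda_i-\overline{\lambda_j}|^2\,d\mu^N(\lambda_1,\dots,\lambda_N)$; the scaled eigenvalues are these divided by $\sqrt{2N}$. Conditioning is on the eigenvalues together with this labelling. Schur form (known fact): $G$ is unitarily equivalent to a block upper-triangular matrix with $2\times 2$ diagonal blocks $\mathrm{diag}(\lambda_i,\overline{\lambda_i})$ ($\lambda_i$ the unscaled eigenvalues) and upper-diagonal blocks $T_{i,j}=\begin{pmatrix}u_{i,j}&v_{i,j}\\-\overline{v_{i,j}}&\overline{u_{i,j}}\end{pmatrix}$, $i<j$, where all $u_{i,j},v_{i,j}$ are i.i.d. standard complex Gaussian variables, independent of the diagonal blocks. Statistics of eigenvectors are computed on the Schur form. Almost surely all $2N$ eigenvalues are distinct. For a matrix with distinct eigenvalues written $P\Delta P^{-1}$ with $\Delta$ diagonal, the columns of $P$ are right eigenvectors $R_i$ and the rows of $P^{-1}$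 are left eigenvectors $L_i$, with $L_iR_j=\delta_{i,j}$. The overlap between the eigenvectors of two eigenvalues $\lambda_i,\lambda_j$ is $\mathscr{O}(\lambda_i,\lambda_j)=(R_i^*R_j)(L_jL_i^* )$ (independent of the choice of $P$), and $\mathscr{O}_{1,1}:=\mathscr{O}(\lambda_1,\lambda_1)=\|R_1\|^2\|L_1\|^2$, which also equals $\mathscr{O}(\overline{\lambda_1},\overline{\lambda_1})$. *)

theory Defs
  imports
    "HOL-Probability.Probability"
    "Jordan_Normal_Form.Schur_Decomposition"
    "Jordan_Normal_Form.Spectral_Radius"
begin

(* Matrices are the carrier-based ones of Jordan_Normal_Form (their entries are indexed
   from 0), since the dimension 2N varies with N; HOL-Analysis uses some of the same names. *)
hide_const (open) Finite_Cartesian_Product.mat Finite_Cartesian_Product.row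
  Finite_Cartesian_Product.column Finite_Cartesian_Product.vec Determinants.det

definition std_complex_gaussian :: "complex measure" where
  "std_complex_gaussian = density lborel (\<lambda>z. ennreal (exp (- (cmod z)\<^sup>2) / pi))"

definition iid_std_complex_gaussian ::
    "'w measure \<Rightarrow> 'i set \<Rightarrow> ('i \<Rightarrow> 'w \<Rightarrow> complex) \<Rightarrow> bool" where
  "iid_std_complex_gaussian M I X \<longleftrightarrow>
     prob_space.indep_vars M (\<lambda>_. borel) X I \<and>
     (\<forall>i\<in>I. distr M borel (X i) = std_complex_gaussian)"

(* The sigma-algebra on the sample space generated by the family (X i), i in I. *)
definition generated_algebra ::
    "'w measure \<Rightarrow> 'i set \<Rightarrow> ('i \<Rightarrow> 'w \<Rightarrow> complex) \<Rightarrow> 'w measure" where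
  "generated_algebra M I X =
     vimage_algebra (space M) (\<lambda>\<omega>. \<lambda>i\<in>I. X i \<omega>) (\<Pi>\<^sub>M i\<in>I. borel)"

definition indep_families ::
    "'w measure \<Rightarrow> 'i set \<Rightarrow> ('i \<Rightarrow> 'w \<Rightarrow> complex) \<Rightarrow> 'j set \<Rightarrow> ('j \<Rightarrow> 'w \<Rightarrow> complex) \<Rightarrow> bool" where
  "indep_families M I X J Y \<longleftrightarrow>
     prob_space.indep_set M (sets (generated_algebra M I X)) (sets (generated_algebra M J Y))"

(* X and Y have the same conditional law given F, almost everywhere on the event E.  The
   conditional probabilities are the conditional expectations of the indicators. *)
definition cond_eq_in_distribution ::
    "'w measure \<Rightarrow> 'w measure \<Rightarrow> 'w set \<Rightarrow> ('w \<Rightarrow> real) \<Rightarrow> ('w \<Rightarrow> real) \<Rightarrow> bool" where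
  "cond_eq_in_distribution M F E X Y \<longleftrightarrow>
     (\<forall>B\<in>sets borel. AE \<omega> in M. \<omega> \<in> E \<longrightarrow>
        real_cond_exp M F (indicat_real (X -` B \<inter> space M)) \<omega> =
        real_cond_exp M F (indicat_real (Y -` B \<inter> space M)) \<omega>)"

definition Psi :: "complex set \<Rightarrow> complex set" where
  "Psi A = A \<union> cnj ` A"

definition mat2 :: "complex \<Rightarrow> complex \<Rightarrow> complex \<Rightarrow> complex \<Rightarrow> complex mat" where
  "mat2 a b c d = mat_of_rows_list 2 [[a, b], [c, d]]"

(* The blocks B i j are numbered by i, j in {1..N}. *)
definition block_mat :: "nat \<Rightarrow> (nat \<Rightarrow> nat \<Rightarrow> complex mat) \<Rightarrow> complex mat" where
  "block_mat N B = Matrix.mat (2 * N) (2 * N)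
     (\<lambda>(r, c). B (r div 2 + 1) (c div 2 + 1) $$ (r mod 2, c mod 2))"

definition quaternionic_mat ::
    "nat \<Rightarrow> (nat \<Rightarrow> nat \<Rightarrow> complex) \<Rightarrow> (nat \<Rightarrow> nat \<Rightarrow> complex) \<Rightarrow> complex mat" where
  "quaternionic_mat N z w =
     block_mat N (\<lambda>i j. mat2 (z i j) (- cnj (w i j)) (w i j) (cnj (z i j)))"

definition schur_mat ::
    "nat \<Rightarrow> (nat \<Rightarrow> complex) \<Rightarrow> (nat \<Rightarrow> nat \<Rightarrow> complex) \<Rightarrow> (nat \<Rightarrow> nat \<Rightarrow> complex) \<Rightarrow> complex mat" where
  "schur_mat N l u v = block_mat N (\<lambda>i j.
     if i < j then mat2 (u i j) (v i j) (- cnj (v i j)) (cnj (u i j))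
     else if i = j then mat2 (l i) 0 0 (cnj (l i))
     else 0\<^sub>m 2 2)"

definition unitarily_equivalent :: "complex mat \<Rightarrow> complex mat \<Rightarrow> bool" where
  "unitarily_equivalent A B \<longleftrightarrow> (\<exists>U. similar_mat_wit A B U (mat_adjoint U))"

(* The density, with respect to the N-fold product of the standard complex Gaussian measure,
   of the labelled unscaled eigenvalues, up to the normalisation constant. *)
definition eigenvalue_weight :: "nat \<Rightarrow> (nat \<Rightarrow> complex) \<Rightarrow> real" where
  "eigenvalue_weight N l =
     (\<Prod>(i, j)\<in>{(i, j). 1 \<le> i \<and> i < j \<and> j \<le> N}. (cmod (l i - l j))\<^sup>2) *
     (\<Prod>(i, j)\<in>{(i, j). 1 \<le> i \<and> i \<le> j \<and> j \<le> N}. (cmod (l i - cnj (l j)))\<^sup>2)"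

(* With A = P D Q, Q the inverse of P and D diagonal: R_i = col P i, L_i = row Q i.  As
   x \<bullet>c y conjugates its second argument, R_i^* R_j = col P j \<bullet>c col P i and
   L_j L_i^* = row Q j \<bullet>c row Q i.  The overlap is only meaningful for a matrix with distinct
   eigenvalues, where it does not depend on P; it is set to 0 otherwise. *)
definition overlap :: "complex mat \<Rightarrow> complex \<Rightarrow> complex \<Rightarrow> complex" where
  "overlap A a b =
     (if card (spectrum A) = dim_row A then
        (THE x. \<exists>P D Q i j. similar_mat_wit A D P Q \<and> diagonal_mat D \<and>
           i < dim_row A \<and> j < dim_row A \<and> D $$ (i, i) = a \<and> D $$ (j, j) = b \<and>
           x = (col P j \<bullet>c col P i) * (row Q j \<bullet>c row Q i))
      else 0)"

(* overlap A a a is the non-negative real number |R|^2 |L|^2. *)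
definition diagonal_overlap :: "complex mat \<Rightarrow> complex \<Rightarrow> real" where
  "diagonal_overlap A a = Re (overlap A a a)"

end

theory Submission
  imports Defs
begin

text \<open>
The overlap does not change under a unitary change of basis, so it can be computed on the Schur
form \<open>T\<close>.  There the right eigenvector for \<open>\<lambda>\<^sub>1\<close> is the first basis vector, and the left
eigenvector with first coordinate \<open>1\<close> consists of row blocks \<open>B\<^sub>1 = (1, 0)\<close> and
\<open>B\<^sub>k = (\<Sum>i<k. B\<^sub>i T\<^sub>i\<^sub>,\<^sub>k) (\<lambda>\<^sub>1 - \<Lambda>\<^sub>k)\<^sup>-\<^sup>1\<close>, where \<open>\<Lambda>\<^sub>k = diag(\<lambda>\<^sub>k, cnj \<lambda>\<^sub>k)\<close>.  Therefore the
overlap is \<open>S\<^sub>N\<close>, where \<open>S\<^sub>k = |B\<^sub>1|\<^sup>2 + \<dots> + |B\<^sub>k|\<^sup>2\<close> (\<open>diagonal_overlap_schur_mat\<close>).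

Fix the eigenvalues and the columns of \<open>T\<close> up to \<open>k\<close>.  A block \<open>T\<^sub>i\<^sub>,\<^sub>k\<^sub>+\<^sub>1\<close> is a quaternion with
Gaussian coordinates, and multiplying it from the left by the fixed quaternion \<open>B\<^sub>i\<close> is a similarity
with factor \<open>|B\<^sub>i|\<close>.  The law of a Gaussian quaternion is rotation invariant and Gaussian variances
add up, so \<open>\<Sum>i\<le>k. B\<^sub>i T\<^sub>i\<^sub>,\<^sub>k\<^sub>+\<^sub>1\<close> has the law of \<open>sqrt S\<^sub>k (X, Y)\<close> with independent standard complex
Gaussian \<open>X\<close> and \<open>Y\<close> (\<open>gaussian_quat_sum\<close>).  Dividing its two coordinates by
\<open>\<lambda>\<^sub>1 - \<lambda>\<^sub>k\<^sub>+\<^sub>1\<close> and \<open>\<lambda>\<^sub>1 - cnj \<lambda>\<^sub>k\<^sub>+\<^sub>1\<close> shows that \<open>S\<^sub>k\<^sub>+\<^sub>1\<close> has the law of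
\<open>S\<^sub>k (1 + |X|\<^sup>2 / |\<lambda>\<^sub>1 - \<lambda>\<^sub>k\<^sub>+\<^sub>1|\<^sup>2 + |Y|\<^sup>2 / |\<lambda>\<^sub>1 - cnj \<lambda>\<^sub>k\<^sub>+\<^sub>1|\<^sup>2)\<close> with \<open>(X, Y)\<close> independent of
\<open>S\<^sub>k\<close>; induction on \<open>k\<close> gives the product (\<open>overlap_sum_distributed_as_product\<close>).

Both \<open>T\<^sub>i\<^sub>,\<^sub>j\<close> and the variables \<open>X\<^sub>k, Y\<^sub>k\<close> of the product are independent of the eigenvalues, so a
conditional expectation given the eigenvalues is an integral over these variables with the
eigenvalues held fixed (\<open>real_cond_exp_indep_families\<close>).  Eigenvalues that coincide, or that are
real, are an exceptional null event, because the joint density of the eigenvalues vanishes there.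
\<close>

section \<open>Overlaps of triangular matrices\<close>

lemma index_mat_adjoint:
  fixes U :: "complex mat"
  assumes "U \<in> carrier_mat n m" "i < m" "j < n"
  shows "mat_adjoint U $$ (i, j) = cnj (U $$ (j, i))"
  using assms by (simp add: mat_adjoint_def mat_of_rows_def conjugate_complex_def)

lemma dim_mat_adjoint [simp]:
  "dim_row (mat_adjoint U) = dim_col U" "dim_col (mat_adjoint U) = dim_row U"
  by (simp_all add: mat_adjoint_def)

text \<open>This is needed twice for a unitary change of basis, which acts on the columns of an eigenvector
matrix and on the rows of its inverse.\<close>

lemma orthonormal_rows_inner:
  fixes V :: "nat \<Rightarrow> nat \<Rightarrow> complex"
  assumes "\<And>k m. k < n \<Longrightarrow> m < n \<Longrightarrow> (\<Sum>r<n. V k r * cnj (V m r)) = (if k = m then 1 else 0)"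
  shows "(\<Sum>r<n. (\<Sum>k<n. x k * V k r) * cnj (\<Sum>m<n. y m * V m r)) = (\<Sum>k<n. x k * cnj (y k))"
proof -
  have "(\<Sum>r<n. (\<Sum>k<n. x k * V k r) * cnj (\<Sum>m<n. y m * V m r)) =
     (\<Sum>r<n. \<Sum>k<n. \<Sum>m<n. x k * cnj (y m) * (V k r * cnj (V m r)))"
    by (simp add: sum_product algebra_simps)
  also have "\<dots> = (\<Sum>k<n. \<Sum>r<n. \<Sum>m<n. x k * cnj (y m) * (V k r * cnj (V m r)))"
    by (rule sum.swap)
  also have "\<dots> = (\<Sum>k<n. \<Sum>m<n. \<Sum>r<n. x k * cnj (y m) * (V k r * cnj (V m r)))"
    by (intro sum.cong refl sum.swap)
  also have "\<dots> = (\<Sum>k<n. \<Sum>m<n. x k * cnj (y m) * (if k = m then 1 else 0))"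
    by (intro sum.cong refl) (simp add: assms flip: sum_distrib_left)
  also have "\<dots> = (\<Sum>k<n. x k * cnj (y k))"
    by (simp add: if_distrib cong: if_cong)
  finally show ?thesis .
qed

lemma index_mult_mat_sum:
  "A \<in> carrier_mat n m \<Longrightarrow> B \<in> carrier_mat m k \<Longrightarrow> i < n \<Longrightarrow> j < k \<Longrightarrow>
    (A * B) $$ (i, j) = (\<Sum>r<m. A $$ (i, r) * B $$ (r, j))"
  by (simp add: scalar_prod_def atLeast0LessThan)

lemma col_inner_col:
  fixes P :: "complex mat"
  shows "P \<in> carrier_mat n m \<Longrightarrow> i < m \<Longrightarrow> j < m \<Longrightarrow>
    col P j \<bullet>c col P i = (\<Sum>r<n. P $$ (r, j) * cnj (P $$ (r, i)))"
  by (simp add: scalar_prod_def atLeast0LessThan conjugate_complex_def)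

lemma row_inner_row:
  fixes Q :: "complex mat"
  shows "Q \<in> carrier_mat n m \<Longrightarrow> i < n \<Longrightarrow> j < n \<Longrightarrow>
    row Q j \<bullet>c row Q i = (\<Sum>r<m. Q $$ (j, r) * cnj (Q $$ (i, r)))"
  by (simp add: scalar_prod_def atLeast0LessThan conjugate_complex_def)

lemma spectrum_similar_mat:
  fixes A B :: "complex mat"
  assumes "similar_mat A B"
  shows "spectrum A = spectrum B"
proof -
  from similar_matD[OF assms] obtain n where "A \<in> carrier_mat n n" "B \<in> carrier_mat n n" by auto
  then show ?thesis
    using char_poly_similar[OF assms] by (simp add: spectrum_root_char_poly)
qed

text \<open>The relation under the description operator of \<^const>\<open>overlap\<close>.  It can be transported from one
matrix to another before it is known that only one value satisfies it.\<close>

definition overlap_value :: "complex mat \<Rightarrow> complex \<Rightarrow> complex \<Rightarrow> complex \<Rightarrow> bool" where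
  "overlap_value A a b x \<longleftrightarrow> (\<exists>P D Q i j. similar_mat_wit A D P Q \<and> diagonal_mat D \<and>
     i < dim_row A \<and> j < dim_row A \<and> D $$ (i, i) = a \<and> D $$ (j, j) = b \<and>
     x = (col P j \<bullet>c col P i) * (row Q j \<bullet>c row Q i))"

lemma overlap_eq_the_value:
  "overlap A a b = (if card (spectrum A) = dim_row A then THE x. overlap_value A a b x else 0)"
  unfolding overlap_def overlap_value_def ..

text \<open>If \<open>A = P D Q\<close>, then \<open>B = (U\<^sup>* P) D (Q U)\<close>.  The matrix \<open>U\<^sup>*\<close> preserves the inner products of the
columns of \<open>P\<close>, and \<open>U\<close> those of the rows of \<open>Q\<close>.\<close>

lemma overlap_value_unitary:
  assumes UB: "similar_mat_wit A B U (mat_adjoint U)" and x: "overlap_value A a b x"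
  shows "overlap_value B a b x"
proof -
  define n where "n = dim_row A"
  note U = similar_mat_witD[OF n_def UB]
  from x obtain P D Q i j where wit: "similar_mat_wit A D P Q" and D: "diagonal_mat D"
    and ij: "i < n" "j < n" "D $$ (i, i) = a" "D $$ (j, j) = b"
    and x: "x = (col P j \<bullet>c col P i) * (row Q j \<bullet>c row Q i)"
    unfolding overlap_value_def n_def by blast
  note P = similar_mat_witD[OF n_def wit]
  let ?P = "mat_adjoint U * P" and ?Q = "Q * U"
  have "similar_mat_wit B D ?P ?Q"
    by (rule similar_mat_wit_trans[OF similar_mat_wit_sym[OF UB] wit])
  have rows: "(\<Sum>r<n. U $$ (k, r) * cnj (U $$ (m, r))) = (if k = m then 1 else 0)"
    if "k < n" "m < n" for k m
  proof -
    have "(\<Sum>r<n. U $$ (k, r) * cnj (U $$ (m, r))) = (U * mat_adjoint U) $$ (k, m)"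
      unfolding index_mult_mat_sum[OF U(6,7) that]
      by (intro sum.cong refl) (simp add: index_mat_adjoint[OF U(6)] that)
    then show ?thesis using that by (simp add: U(1))
  qed
  have cols: "(\<Sum>r<n. cnj (U $$ (k, r)) * cnj (cnj (U $$ (m, r)))) = (if k = m then 1 else 0)"
    if "k < n" "m < n" for k m
    using arg_cong[OF rows[OF that], of cnj] by (simp add: if_distrib cong: if_cong)
  have P': "?P $$ (r, c) = (\<Sum>k<n. P $$ (k, c) * cnj (U $$ (k, r)))" if "r < n" "c < n" for r c
    unfolding index_mult_mat_sum[OF U(7) P(6) that]
    by (intro sum.cong refl) (simp add: index_mat_adjoint[OF U(6)] that)
  have Q': "?Q $$ (r, c) = (\<Sum>k<n. Q $$ (r, k) * U $$ (k, c))" if "r < n" "c < n" for r c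
    by (rule index_mult_mat_sum[OF P(7) U(6) that])
  have carr: "?P \<in> carrier_mat n n" "?Q \<in> carrier_mat n n" using U P by auto
  have "col ?P j \<bullet>c col ?P i = col P j \<bullet>c col P i"
    unfolding col_inner_col[OF carr(1) ij(1,2)] col_inner_col[OF P(6) ij(1,2)]
    using orthonormal_rows_inner[of n "\<lambda>k r. cnj (U $$ (k, r))", OF cols] ij by (simp add: P')
  moreover have "row ?Q j \<bullet>c row ?Q i = row Q j \<bullet>c row Q i"
    unfolding row_inner_row[OF carr(2) ij(1,2)] row_inner_row[OF P(7) ij(1,2)]
    using orthonormal_rows_inner[of n "\<lambda>k r. U $$ (k, r)", OF rows] ij by (simp add: Q')
  ultimately show ?thesis
    unfolding overlap_value_def x
    using \<open>similar_mat_wit B D ?P ?Q\<close> D ij U(5) by (metis carrier_matD(1))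
qed

lemma overlap_unitarily_equivalent:
  assumes "unitarily_equivalent A B"
  shows "overlap A a b = overlap B a b"
proof -
  from assms obtain U where UB: "similar_mat_wit A B U (mat_adjoint U)"
    unfolding unitarily_equivalent_def by blast
  define n where "n = dim_row A"
  note U = similar_mat_witD[OF n_def UB]
  have adj: "mat_adjoint (mat_adjoint U) = U"
    using U(6,7) by (intro eq_matI) (auto simp: index_mat_adjoint[of _ n n])
  have BU: "similar_mat_wit B A (mat_adjoint U) (mat_adjoint (mat_adjoint U))"
    unfolding adj by (rule similar_mat_wit_sym[OF UB])
  have "spectrum A = spectrum B"
    using UB by (intro spectrum_similar_mat) (auto simp: similar_mat_def)
  moreover have "dim_row A = dim_row B" using U by auto
  moreover have "overlap_value A a b = overlap_value B a b"
    using overlap_value_unitary[OF UB] overlap_value_unitary[OF BU] by blast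
  ultimately show ?thesis
    by (simp add: overlap_eq_the_value)
qed

text \<open>Let \<open>c\<close> be the last position where the eigenvector is non-zero.  In row \<open>c\<close> of the eigenvalue
equation only the diagonal term is left, since entries to the left of the diagonal vanish with the
matrix and entries to the right with the vector.\<close>

lemma upper_triangular_eigenvector_last:
  fixes T :: "complex mat" and y :: "nat \<Rightarrow> complex"
  assumes T: "T \<in> carrier_mat n n" "upper_triangular T"
    and ev: "\<And>r. r < n \<Longrightarrow> (\<Sum>k<n. T $$ (r, k) * y k) = a * y r"
    and nz: "m < n" "y m \<noteq> 0"
  obtains c where "c < n" "y c \<noteq> 0" "T $$ (c, c) = a" "\<And>j. c < j \<Longrightarrow> j < n \<Longrightarrow> y j = 0"
proof -
  define c where "c = Max {j. j < n \<and> y j \<noteq> 0}"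
  have "c \<in> {j. j < n \<and> y j \<noteq> 0}" unfolding c_def using nz by (intro Max_in) auto
  then have c: "c < n" "y c \<noteq> 0" by auto
  have z: "y j = 0" if "c < j" "j < n" for j
    using that Max_ge[of "{j. j < n \<and> y j \<noteq> 0}" j] unfolding c_def by fastforce
  have "(\<Sum>k<n. T $$ (c, k) * y k) = (\<Sum>k<n. if k = c then T $$ (c, c) * y c else 0)"
  proof (intro sum.cong refl)
    fix k assume "k \<in> {..<n}"
    then show "T $$ (c, k) * y k = (if k = c then T $$ (c, c) * y c else 0)"
      using z[of k] upper_triangularD[OF T(2), of k c] T(1) c(1) by (cases k c rule: linorder_cases) auto
  qed
  then have "T $$ (c, c) = a" using ev[OF c(1)] c by simp
  with c z that show ?thesis by blast
qed

lemma spectrum_upper_triangular: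
  fixes T :: "complex mat"
  assumes "T \<in> carrier_mat n n" "upper_triangular T"
  shows "spectrum T = set (diag_mat T)"
  unfolding spectrum_root_char_poly[OF assms(1)] char_poly_upper_triangular[OF assms]
  by (auto simp: poly_prod_list prod_list_zero_iff)

text \<open>An eigenvector for the \<open>c\<close>-th diagonal entry has its last non-zero entry at position \<open>c\<close>, because
the diagonal entries differ.  The eigenvectors are therefore the columns of an upper triangular
matrix with non-zero diagonal, which is invertible.\<close>

lemma upper_triangular_diagonalizable:
  fixes T :: "complex mat"
  assumes T: "T \<in> carrier_mat n n" "upper_triangular T" and d: "distinct (diag_mat T)"
  obtains D P Q where "similar_mat_wit T D P Q" "diagonal_mat D" "\<And>i. i < n \<Longrightarrow> D $$ (i, i) = T $$ (i, i)"
proof -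
  have inj: "i = j" if "T $$ (i, i) = T $$ (j, j)" "i < n" "j < n" for i j
    using d that T(1) by (auto simp: distinct_conv_nth diag_mat_def)
  have "\<exists>y. y c \<noteq> 0 \<and> (\<forall>j. c < j \<and> j < n \<longrightarrow> y j = 0) \<and>
      (\<forall>r<n. (\<Sum>k<n. T $$ (r, k) * y k) = T $$ (c, c) * y r)" if c: "c < n" for c
  proof -
    have "T $$ (c, c) \<in> spectrum T"
      unfolding spectrum_upper_triangular[OF T] using c T(1) by (auto simp: diag_mat_def)
    then obtain w where w: "w \<in> carrier_vec n" "w \<noteq> 0\<^sub>v n" "T *\<^sub>v w = T $$ (c, c) \<cdot>\<^sub>v w"
      using T(1) by (auto simp: spectrum_def eigenvalue_def eigenvector_def)
    have ev: "(\<Sum>k<n. T $$ (r, k) * w $ k) = T $$ (c, c) * w $ r" if "r < n" for r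
      using arg_cong[OF w(3), of "\<lambda>x. x $ r"] that T(1) w(1)
      by (simp add: scalar_prod_def atLeast0LessThan)
    obtain m where "m < n" "w $ m \<noteq> 0" using w(1,2) by (metis eq_vecI carrier_vecD index_zero_vec)
    from upper_triangular_eigenvector_last[OF T ev this] obtain c' where
      c': "c' < n" "w $ c' \<noteq> 0" "T $$ (c', c') = T $$ (c, c)" "\<And>j. c' < j \<Longrightarrow> j < n \<Longrightarrow> w $ j = 0"
      by blast
    have "c' = c" by (rule inj) (use c c' in auto)
    with c' ev show ?thesis by (intro exI[of _ "\<lambda>k. w $ k"]) auto
  qed
  then have "\<forall>c. \<exists>y. c < n \<longrightarrow> (y c \<noteq> 0 \<and> (\<forall>j. c < j \<and> j < n \<longrightarrow> y j = 0) \<and>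
      (\<forall>r<n. (\<Sum>k<n. T $$ (r, k) * y k) = T $$ (c, c) * y r))"
    by blast
  from choice[OF this] obtain y where y': "\<forall>c. c < n \<longrightarrow> (y c c \<noteq> 0 \<and> (\<forall>j. c < j \<and> j < n \<longrightarrow> y c j = 0) \<and>
      (\<forall>r<n. (\<Sum>k<n. T $$ (r, k) * y c k) = T $$ (c, c) * y c r))" ..
  then have y: "\<And>c. c < n \<Longrightarrow> y c c \<noteq> 0" "\<And>c j. c < j \<Longrightarrow> j < n \<Longrightarrow> y c j = 0"
     "\<And>c r. c < n \<Longrightarrow> r < n \<Longrightarrow> (\<Sum>k<n. T $$ (r, k) * y c k) = T $$ (c, c) * y c r"
    by (blast intro: order.strict_trans)+
  define P where "P = Matrix.mat n n (\<lambda>(r, c). y c r)"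
  define D where "D = Matrix.mat n n (\<lambda>(r, c). if r = c then T $$ (c, c) else 0)"
  have carr: "P \<in> carrier_mat n n" "D \<in> carrier_mat n n" by (auto simp: P_def D_def)
  have "upper_triangular P" by (auto simp: P_def y(2))
  then have "det P \<noteq> 0"
    unfolding upper_triangular_imp_det_eq_0_iff[OF carr(1) \<open>upper_triangular P\<close>]
    using y(1) by (auto simp: diag_mat_def P_def)
  then obtain Q where Q: "Q \<in> carrier_mat n n" "Q * P = 1\<^sub>m n" "P * Q = 1\<^sub>m n"
    using det_non_zero_imp_unit[OF carr(1)] mat_mult_left_right_inverse[OF carr(1)]
    by (auto simp: Units_def ring_mat_def)
  have TP: "T * P = P * D"
  proof (rule eq_matI)
    fix r c assume rc: "r < dim_row (P * D)" "c < dim_col (P * D)"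
    then have rc: "r < n" "c < n" using carr by auto
    have "(P * D) $$ (r, c) = (\<Sum>k<n. if k = c then y c r * T $$ (c, c) else 0)"
      unfolding index_mult_mat_sum[OF carr rc]
      by (intro sum.cong refl) (use rc in \<open>auto simp: P_def D_def\<close>)
    moreover have "(T * P) $$ (r, c) = T $$ (c, c) * y c r"
      unfolding index_mult_mat_sum[OF T(1) carr(1) rc]
      using y(3)[OF rc(2,1)] rc by (simp add: P_def)
    ultimately show "(T * P) $$ (r, c) = (P * D) $$ (r, c)" using rc by simp
  qed (use T carr in auto)
  have "T = T * (P * Q)" using T(1) Q by simp
  also have "\<dots> = P * D * Q" using T(1) carr Q TP by (metis assoc_mult_mat)
  finally have "similar_mat_wit T D P Q"
    by (intro similar_mat_witI[OF Q(3,2) _ T(1) carr(2,1) Q(1)])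
  moreover have "diagonal_mat D" by (auto simp: D_def diagonal_mat_def)
  moreover have "D $$ (i, i) = T $$ (i, i)" if "i < n" for i using that by (simp add: D_def)
  ultimately show thesis by (rule that)
qed

text \<open>The right eigenvector for the first diagonal entry is a multiple of the first basis vector, as its
last non-zero position can only be \<open>0\<close>.  The normalisation \<open>L R = 1\<close> then makes the product of the
squared norms equal to the squared norm of the left eigenvector with first coordinate \<open>1\<close>.\<close>

lemma overlap_triangular:
  fixes T :: "complex mat" and x :: "nat \<Rightarrow> complex"
  assumes T: "T \<in> carrier_mat n n" "upper_triangular T" and n: "0 < n"
    and d: "distinct (diag_mat T)"
    and left: "\<And>w. (\<And>c. c < n \<Longrightarrow> (\<Sum>r<n. w r * T $$ (r, c)) = T $$ (0, 0) * w c) \<Longrightarrow>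
                 (\<And>c. c < n \<Longrightarrow> w c = w 0 * x c)"
    and x0: "x 0 = 1"
  shows "overlap T (T $$ (0, 0)) (T $$ (0, 0)) = of_real (\<Sum>c<n. (cmod (x c))\<^sup>2)"
proof -
  let ?a = "T $$ (0, 0)"
  have spec: "card (spectrum T) = dim_row T"
    unfolding spectrum_upper_triangular[OF T] distinct_card[OF d] using T(1) by (simp add: diag_mat_def)
  have dT: "n = dim_row T" using T by auto
  have inj: "i = j" if "T $$ (i, i) = T $$ (j, j)" "i < n" "j < n" for i j
    using d that T(1) by (auto simp: distinct_conv_nth diag_mat_def)
  have val: "z = of_real (\<Sum>c<n. (cmod (x c))\<^sup>2)" if "overlap_value T ?a ?a z" for z
  proof -
    from that obtain P D Q i j where wit: "similar_mat_wit T D P Q" and D: "diagonal_mat D"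
      and ij: "i < n" "j < n" "D $$ (i, i) = ?a" "D $$ (j, j) = ?a"
      and z: "z = (col P j \<bullet>c col P i) * (row Q j \<bullet>c row Q i)"
      unfolding overlap_value_def dT by blast
    note P = similar_mat_witD[OF dT wit]
    have Dud: "upper_triangular D" using D P(5) by (auto simp: diagonal_mat_def)
    have "spectrum D = spectrum T"
      using wit by (intro spectrum_similar_mat[symmetric]) (auto simp: similar_mat_def)
    then have "card (set (diag_mat D)) = length (diag_mat D)"
      using spec P(5) dT by (simp add: spectrum_upper_triangular[OF P(5) Dud] diag_mat_def)
    then have "distinct (diag_mat D)" by (rule card_distinct)
    then have "i = j" using ij P(5) by (auto simp: distinct_conv_nth diag_mat_def) metis
    have Dd: "D $$ (r, c) = (if r = c then D $$ (c, c) else 0)" if "r < n" "c < n" for r c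
      using D P(5) that by (auto simp: diagonal_mat_def)
    note assoc = assoc_mult_mat[of _ n n _ n _ n]
    have "T * P = (P * D * Q) * P" by (simp only: P(3)[symmetric])
    also have "\<dots> = P * D * (Q * P)" using P(5-7) by (simp add: assoc)
    finally have TP: "T * P = P * D" using P(5,6) by (simp add: P(2))
    have "Q * T = Q * (P * D * Q)" by (simp only: P(3)[symmetric])
    also have "\<dots> = (Q * P) * (D * Q)" using P(5-7) by (simp add: assoc)
    finally have QT: "Q * T = D * Q" using P(5,7) by (simp add: P(2))
    define y where "y = (\<lambda>r. P $$ (r, i))"
    define w where "w = (\<lambda>r. Q $$ (i, r))"
    have ev: "(\<Sum>k<n. T $$ (r, k) * y k) = ?a * y r" if "r < n" for r
    proof -
      have "(\<Sum>k<n. T $$ (r, k) * y k) = (P * D) $$ (r, i)"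
        using index_mult_mat_sum[OF T(1) P(6) that ij(1)] by (simp add: TP y_def)
      also have "\<dots> = (\<Sum>k<n. if k = i then y r * ?a else 0)"
        unfolding index_mult_mat_sum[OF P(6,5) that ij(1)]
        by (intro sum.cong refl) (simp add: Dd[OF _ ij(1)] ij(3) y_def)
      finally show ?thesis using ij by simp
    qed
    have lev: "(\<Sum>r<n. w r * T $$ (r, c)) = ?a * w c" if "c < n" for c
    proof -
      have "(\<Sum>r<n. w r * T $$ (r, c)) = (D * Q) $$ (i, c)"
        using index_mult_mat_sum[OF P(7) T(1) ij(1) that] by (simp add: QT w_def)
      also have "\<dots> = (\<Sum>k<n. if k = i then ?a * w c else 0)"
        unfolding index_mult_mat_sum[OF P(5,7) ij(1) that]
        by (intro sum.cong refl) (use ij(3) Dd[OF ij(1)] in \<open>simp add: w_def\<close>)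
      finally show ?thesis using ij by simp
    qed
    have wy: "(\<Sum>r<n. w r * y r) = 1"
      using index_mult_mat_sum[OF P(7,6) ij(1,1)] ij by (simp add: P(2) w_def y_def)
    have "\<exists>m<n. y m \<noteq> 0"
    proof (rule ccontr)
      assume "\<not> (\<exists>m<n. y m \<noteq> 0)"
      then have "(\<Sum>r<n. w r * y r) = (\<Sum>r<n. 0)" by (intro sum.cong refl) auto
      then show False using wy by simp
    qed
    then obtain m where "m < n" "y m \<noteq> 0" by blast
    from upper_triangular_eigenvector_last[OF T ev this] obtain c where
      c: "c < n" "T $$ (c, c) = ?a" "\<And>j. c < j \<Longrightarrow> j < n \<Longrightarrow> y j = 0" by metis
    have "c = 0" using inj[OF c(2,1) n] .
    have y0: "y r = 0" if "r < n" "r \<noteq> 0" for r using c(3) \<open>c = 0\<close> that by auto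
    have "(\<Sum>r<n. w r * y r) = (\<Sum>r<n. if r = 0 then w 0 * y 0 else 0)"
      by (intro sum.cong refl) (use y0 in auto)
    then have wy0: "w 0 * y 0 = 1" using n wy by simp
    have wx: "w c = w 0 * x c" if "c < n" for c using left[of w] lev that by blast
    have "col P j \<bullet>c col P i = (\<Sum>r<n. if r = 0 then y 0 * cnj (y 0) else 0)"
      unfolding \<open>i = j\<close>[symmetric] col_inner_col[OF P(6) ij(1,1)] y_def[symmetric]
      by (intro sum.cong refl) (use y0 in \<open>auto simp: y_def\<close>)
    then have 1: "col P j \<bullet>c col P i = y 0 * cnj (y 0)" using n by simp
    have "row Q j \<bullet>c row Q i = (\<Sum>c<n. w c * cnj (w c))"
      unfolding \<open>i = j\<close>[symmetric] row_inner_row[OF P(7) ij(1,1)] w_def ..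
    also have "\<dots> = (\<Sum>c<n. (w 0 * cnj (w 0)) * of_real ((cmod (x c))\<^sup>2))"
    proof (intro sum.cong refl)
      fix c assume "c \<in> {..<n}"
      then have "c < n" by simp
      note wx[OF this]
      then show "w c * cnj (w c) = (w 0 * cnj (w 0)) * of_real ((cmod (x c))\<^sup>2)"
        by (simp only: complex_norm_square complex_cnj_mult ac_simps)
    qed
    finally have 2: "row Q j \<bullet>c row Q i = (w 0 * cnj (w 0)) * of_real (\<Sum>c<n. (cmod (x c))\<^sup>2)"
      by (simp add: sum_distrib_left)
    have "z = (w 0 * y 0) * cnj (w 0 * y 0) * of_real (\<Sum>c<n. (cmod (x c))\<^sup>2)"
      unfolding z 1 2 by simp
    then show ?thesis unfolding wy0 by simp
  qed
  obtain D P Q where "similar_mat_wit T D P Q" "diagonal_mat D" "\<And>i. i < n \<Longrightarrow> D $$ (i, i) = T $$ (i, i)"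
    using upper_triangular_diagonalizable[OF T d] by metis
  then have "\<exists>z. overlap_value T ?a ?a z"
    unfolding overlap_value_def dT[symmetric] using n by blast
  then have "(THE z. overlap_value T ?a ?a z) = of_real (\<Sum>c<n. (cmod (x c))\<^sup>2)"
    using val by (intro the_equality) auto
  then show ?thesis
    unfolding overlap_eq_the_value using spec by simp
qed

section \<open>The left eigenvector of the Schur form\<close>

text \<open>A pair \<open>(b, d)\<close> stands for the quaternion with matrix \<open>mat2 b d (- cnj d) (cnj b)\<close>, of which it is
the first row.  This is quaternion multiplication, or the row \<open>p\<close> times the block of \<open>q\<close>.\<close>

definition quat_mult :: "complex \<times> complex \<Rightarrow> complex \<times> complex \<Rightarrow> complex \<times> complex" where
  "quat_mult p q = (fst p * fst q - snd p * cnj (snd q), fst p * snd q + snd p * cnj (fst q))"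

text \<open>The blocks of the left eigenvector of the Schur form for the eigenvalue \<open>l 1\<close>, scaled to begin with
\<open>1\<close>; the recursion solves \<open>B\<^sub>k (l\<^sub>1 - \<Lambda>\<^sub>k) = (\<Sum>i<k. B\<^sub>i T\<^sub>i\<^sub>,\<^sub>k)\<close> for \<open>B\<^sub>k\<close>.\<close>

fun left_block ::
    "(nat \<Rightarrow> complex) \<Rightarrow> (nat \<Rightarrow> nat \<Rightarrow> complex) \<Rightarrow> (nat \<Rightarrow> nat \<Rightarrow> complex) \<Rightarrow> nat \<Rightarrow> complex \<times> complex" where
  "left_block l u v k = (if k \<le> 1 then (1, 0) else
     let S = \<Sum>i\<in>{1..<k}. quat_mult (left_block l u v i) (u i k, v i k)
     in (fst S / (l 1 - l k), snd S / (l 1 - cnj (l k))))"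

declare left_block.simps [simp del]

lemma sum_even_odd: "(\<Sum>r<2 * n. f r) = (\<Sum>p<n. f (2 * p) + f (2 * p + 1 :: nat))"
  for f :: "nat \<Rightarrow> 'a::comm_monoid_add"
  by (induction n) (simp_all add: add.assoc)

lemma mat2_index:
  "mat2 a b c d $$ (0, 0) = a" "mat2 a b c d $$ (0, Suc 0) = b"
  "mat2 a b c d $$ (Suc 0, 0) = c" "mat2 a b c d $$ (Suc 0, Suc 0) = d"
  by (simp_all add: mat2_def mat_of_rows_list_def)

lemma schur_mat_carrier: "schur_mat N l u v \<in> carrier_mat (2 * N) (2 * N)"
  by (simp add: schur_mat_def block_mat_def)

lemma schur_mat_index:
  assumes "p < N" "q < N"
  shows "schur_mat N l u v $$ (2 * p, 2 * q) =
           (if p < q then u (p + 1) (q + 1) else if p = q then l (p + 1) else 0)"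
    and "schur_mat N l u v $$ (2 * p, 2 * q + 1) = (if p < q then v (p + 1) (q + 1) else 0)"
    and "schur_mat N l u v $$ (2 * p + 1, 2 * q) = (if p < q then - cnj (v (p + 1) (q + 1)) else 0)"
    and "schur_mat N l u v $$ (2 * p + 1, 2 * q + 1) =
           (if p < q then cnj (u (p + 1) (q + 1)) else if p = q then cnj (l (p + 1)) else 0)"
  using assms by (simp_all add: schur_mat_def block_mat_def mat2_index)

lemma even_odd_cases:
  fixes r N :: nat
  assumes "r < 2 * N"
  obtains p where "p < N" "r = 2 * p" | p where "p < N" "r = 2 * p + 1"
proof (cases "even r")
  case True
  then obtain p where "r = 2 * p" by (auto elim: evenE)
  then show ?thesis using assms that(1)[of p] by simp
next
  case False
  then obtain p where "r = 2 * p + 1" by (auto elim: oddE)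
  then show ?thesis using assms that(2)[of p] by simp
qed

lemma upper_triangular_schur_mat: "upper_triangular (schur_mat N l u v)"
proof (rule upper_triangularI)
  fix i j assume ij: "j < i" "i < dim_row (schur_mat N l u v)"
  then have i: "i < 2 * N" and j: "j < 2 * N" using schur_mat_carrier[of N l u v] by auto
  show "schur_mat N l u v $$ (i, j) = 0"
    by (cases rule: even_odd_cases[OF i]; cases rule: even_odd_cases[OF j])
       (use ij(1) in \<open>auto simp: schur_mat_index[simplified]\<close>)
qed

lemma diag_schur_mat:
  "diag_mat (schur_mat N l u v) = map (\<lambda>r. if even r then l (r div 2 + 1) else cnj (l (r div 2 + 1))) [0..<2 * N]"
proof (rule nth_equalityI)
  fix r assume "r < length (diag_mat (schur_mat N l u v))"
  then have r: "r < 2 * N" using schur_mat_carrier[of N l u v] by (simp add: diag_mat_def)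
  then show "diag_mat (schur_mat N l u v) ! r =
      map (\<lambda>r. if even r then l (r div 2 + 1) else cnj (l (r div 2 + 1))) [0..<2 * N] ! r"
    using schur_mat_carrier[of N l u v]
    by (cases rule: even_odd_cases[OF r])
       (simp_all add: diag_mat_def schur_mat_index[simplified])
qed (use schur_mat_carrier[of N l u v] in \<open>simp add: diag_mat_def\<close>)

text \<open>The zeros of the joint density are exactly the spectra with a coincidence among the \<open>2 N\<close> numbers
\<open>l i\<close>, \<open>cnj (l i)\<close>; the case \<open>i = j\<close> of the second condition excludes real eigenvalues.\<close>

lemma eigenvalue_weight_nonzero_iff:
  "eigenvalue_weight N l \<noteq> 0 \<longleftrightarrow>
     (\<forall>i j. 1 \<le> i \<and> i < j \<and> j \<le> N \<longrightarrow> l i \<noteq> l j) \<and>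
     (\<forall>i j. 1 \<le> i \<and> i \<le> j \<and> j \<le> N \<longrightarrow> l i \<noteq> cnj (l j))"
proof -
  have "finite {(i, j). 1 \<le> i \<and> i < j \<and> j \<le> N}"
    by (rule finite_subset[of _ "{..N} \<times> {..N}"]) auto
  moreover have "finite {(i, j). 1 \<le> i \<and> i \<le> j \<and> j \<le> N}"
    by (rule finite_subset[of _ "{..N} \<times> {..N}"]) auto
  ultimately show ?thesis
    unfolding eigenvalue_weight_def by (auto simp: prod_zero_iff)
qed

lemma distinct_diag_schur_mat_iff:
  "distinct (diag_mat (schur_mat N l u v)) \<longleftrightarrow> eigenvalue_weight N l \<noteq> 0"
proof -
  define g where "g = (\<lambda>r::nat. if even r then l (r div 2 + 1) else cnj (l (r div 2 + 1)))"
  have g: "g (2 * p) = l (p + 1)" "g (2 * p + 1) = cnj (l (p + 1))" for p by (simp_all add: g_def)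
  have "distinct (diag_mat (schur_mat N l u v)) \<longleftrightarrow> inj_on g {..<2 * N}"
    unfolding diag_schur_mat g_def by (simp add: distinct_map atLeast0LessThan)
  also have "\<dots> \<longleftrightarrow> eigenvalue_weight N l \<noteq> 0"
    unfolding eigenvalue_weight_nonzero_iff
  proof (intro iffI conjI allI impI)
    fix i j assume inj: "inj_on g {..<2 * N}" and ij: "1 \<le> i \<and> i < j \<and> j \<le> N"
    then have "g (2 * (i - 1)) \<noteq> g (2 * (j - 1))" by (subst inj_on_eq_iff[OF inj]) auto
    then show "l i \<noteq> l j" using ij by (simp only: g) simp
  next
    fix i j assume inj: "inj_on g {..<2 * N}" and ij: "1 \<le> i \<and> i \<le> j \<and> j \<le> N"
    have "2 * (i - 1) \<noteq> 2 * (j - 1) + 1" by presburger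
    with ij have "g (2 * (i - 1)) \<noteq> g (2 * (j - 1) + 1)" by (subst inj_on_eq_iff[OF inj]) auto
    then show "l i \<noteq> cnj (l j)" using ij by (simp only: g) simp
  next
    assume w: "(\<forall>i j. 1 \<le> i \<and> i < j \<and> j \<le> N \<longrightarrow> l i \<noteq> l j) \<and>
     (\<forall>i j. 1 \<le> i \<and> i \<le> j \<and> j \<le> N \<longrightarrow> l i \<noteq> cnj (l j))"
    have ne: "l (p + 1) \<noteq> l (q + 1)" if "p < N" "q < N" "p \<noteq> q" for p q
      using w that by (cases p q rule: linorder_cases) (auto, metis Suc_le_eq Suc_less_eq le0 not_less_eq_eq One_nat_def)
    have nc: "l (p + 1) \<noteq> cnj (l (q + 1))" if "p < N" "q < N" for p q
    proof (cases "p \<le> q")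
      case True
      then show ?thesis using conjunct2[OF w, rule_format, of "p + 1" "q + 1"] that by simp
    next
      case False
      then have "l (q + 1) \<noteq> cnj (l (p + 1))"
        using conjunct2[OF w, rule_format, of "q + 1" "p + 1"] that by simp
      then show ?thesis by (metis complex_cnj_cnj)
    qed
    show "inj_on g {..<2 * N}"
    proof (rule inj_onI)
      fix r c assume "r \<in> {..<2 * N}" "c \<in> {..<2 * N}" and eq: "g r = g c"
      then have rc: "r < 2 * N" "c < 2 * N" by auto
      show "r = c"
      proof (cases rule: even_odd_cases[OF rc(1)])
        case (1 p)
        show ?thesis
        proof (cases rule: even_odd_cases[OF rc(2)])
          case (1 q)
          then show ?thesis using eq ne[of p q] \<open>p < N\<close> \<open>r = 2 * p\<close> unfolding 1 g by (cases "p = q") (auto simp: g)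
        next
          case (2 q)
          then show ?thesis using eq nc[of p q] \<open>p < N\<close> unfolding 2 \<open>r = 2 * p\<close> g by auto
        qed
      next
        case (2 p)
        show ?thesis
        proof (cases rule: even_odd_cases[OF rc(2)])
          case (1 q)
          then show ?thesis using eq nc[of q p] \<open>p < N\<close> unfolding 1 \<open>r = 2 * p + 1\<close> g by auto
        next
          case (2 q)
          then show ?thesis using eq ne[of p q] \<open>p < N\<close> unfolding 2 \<open>r = 2 * p + 1\<close> g by (cases "p = q") auto
        qed
      qed
    qed
  qed
  finally show ?thesis .
qed

text \<open>Forward substitution in \<open>w T = l\<^sub>1 w\<close>, one block column at a time.  The first block column forces the
second coordinate to vanish, because \<open>l 1\<close> is not real.\<close>

lemma schur_left_eigenvector:
  fixes w :: "nat \<Rightarrow> complex"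
  assumes nz: "eigenvalue_weight N l \<noteq> 0"
    and ev: "\<And>c. c < 2 * N \<Longrightarrow> (\<Sum>r<2 * N. w r * schur_mat N l u v $$ (r, c)) = l 1 * w c"
    and q: "q < N"
  shows "w (2 * q) = w 0 * fst (left_block l u v (q + 1))"
    and "w (2 * q + 1) = w 0 * snd (left_block l u v (q + 1))"
proof -
  have ne1: "l 1 \<noteq> l j" if "1 < j" "j \<le> N" for j
    using nz that unfolding eigenvalue_weight_nonzero_iff by auto
  have ne2: "l 1 \<noteq> cnj (l j)" if "1 \<le> j" "j \<le> N" for j
    using nz that unfolding eigenvalue_weight_nonzero_iff by auto
  have split: "(\<Sum>p<N. if p < q then f p else if p = q then b else 0) = (\<Sum>p<q. f p) + b"
    if "q < N" for f :: "nat \<Rightarrow> complex" and b q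
  proof -
    have "(\<Sum>p<N. if p < q then f p else if p = q then b else 0) =
        (\<Sum>p\<in>insert q {..<q}. if p < q then f p else if p = q then b else 0)"
      using that by (intro sum.mono_neutral_right) auto
    then show ?thesis by (simp add: add.commute)
  qed
  have e0: "(l 1 - l (q + 1)) * w (2 * q) =
      (\<Sum>p<q. w (2 * p) * u (p + 1) (q + 1) - w (2 * p + 1) * cnj (v (p + 1) (q + 1)))"
    if "q < N" for q
  proof -
    have "l 1 * w (2 * q) = (\<Sum>p<N. w (2 * p) * schur_mat N l u v $$ (2 * p, 2 * q) +
        w (2 * p + 1) * schur_mat N l u v $$ (2 * p + 1, 2 * q))"
      using ev[of "2 * q"] that unfolding sum_even_odd by simp
    also have "\<dots> = (\<Sum>p<N. if p < q then w (2 * p) * u (p + 1) (q + 1) - w (2 * p + 1) * cnj (v (p + 1) (q + 1))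
        else if p = q then w (2 * q) * l (q + 1) else 0)"
      by (intro sum.cong refl) (use that in \<open>auto simp: schur_mat_index[simplified]\<close>)
    finally show ?thesis using split[OF that] by (simp add: algebra_simps)
  qed
  have e1: "(l 1 - cnj (l (q + 1))) * w (2 * q + 1) =
      (\<Sum>p<q. w (2 * p) * v (p + 1) (q + 1) + w (2 * p + 1) * cnj (u (p + 1) (q + 1)))"
    if "q < N" for q
  proof -
    have "l 1 * w (2 * q + 1) = (\<Sum>p<N. w (2 * p) * schur_mat N l u v $$ (2 * p, 2 * q + 1) +
        w (2 * p + 1) * schur_mat N l u v $$ (2 * p + 1, 2 * q + 1))"
      using ev[of "2 * q + 1"] that unfolding sum_even_odd by simp
    also have "\<dots> = (\<Sum>p<N. if p < q then w (2 * p) * v (p + 1) (q + 1) + w (2 * p + 1) * cnj (u (p + 1) (q + 1))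
        else if p = q then w (2 * q + 1) * cnj (l (q + 1)) else 0)"
      by (intro sum.cong refl) (use that in \<open>auto simp: schur_mat_index[simplified]\<close>)
    finally show ?thesis using split[OF that] by (simp add: algebra_simps)
  qed
  let ?B = "\<lambda>k. left_block l u v k"
  have "w (2 * q) = w 0 * fst (?B (q + 1)) \<and> w (2 * q + 1) = w 0 * snd (?B (q + 1))"
    using q
  proof (induction q rule: less_induct)
    case (less q)
    show ?case
    proof (cases "q = 0")
      case True
      have "(l 1 - cnj (l 1)) * w 1 = 0" using e1[of 0] less.prems by simp
      then have "w 1 = 0" using ne2[of 1] less.prems by auto
      then show ?thesis using True by (simp add: left_block.simps)
    next
      case False
      let ?S = "\<Sum>i\<in>{1..<q + 1}. quat_mult (?B i) (u i (q + 1), v i (q + 1))"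
      have S: "?S = (\<Sum>p<q. quat_mult (?B (p + 1)) (u (p + 1) (q + 1), v (p + 1) (q + 1)))"
        by (rule sum.reindex_bij_witness[of _ Suc "\<lambda>i. i - 1"]) auto
      have IH: "w (2 * p) = w 0 * fst (?B (p + 1))" "w (2 * p + 1) = w 0 * snd (?B (p + 1))" if "p < q" for p
        using less that by auto
      have B: "?B (q + 1) = (fst ?S / (l 1 - l (q + 1)), snd ?S / (l 1 - cnj (l (q + 1))))"
        using False by (subst left_block.simps) (simp add: Let_def)
      have "(l 1 - l (q + 1)) * w (2 * q) = w 0 * fst ?S"
        unfolding e0[OF less.prems] S fst_sum sum_distrib_left
        by (intro sum.cong refl) (simp only: IH lessThan_iff quat_mult_def fst_conv snd_conv, simp add: algebra_simps)
      moreover have "(l 1 - cnj (l (q + 1))) * w (2 * q + 1) = w 0 * snd ?S"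
        unfolding e1[OF less.prems] S snd_sum sum_distrib_left
        by (intro sum.cong refl) (simp only: IH lessThan_iff quat_mult_def fst_conv snd_conv, simp add: algebra_simps)
      moreover have "l 1 - l (q + 1) \<noteq> 0" "l 1 - cnj (l (q + 1)) \<noteq> 0"
        using ne1[of "q + 1"] ne2[of "q + 1"] less.prems False by auto
      ultimately show ?thesis unfolding B by (simp add: field_simps)
    qed
  qed
  then show "w (2 * q) = w 0 * fst (?B (q + 1))" "w (2 * q + 1) = w 0 * snd (?B (q + 1))" by auto
qed

lemma diagonal_overlap_schur_mat:
  assumes N: "N \<ge> 1" and nz: "eigenvalue_weight N l \<noteq> 0"
    and A: "unitarily_equivalent A (schur_mat N l u v)"
  shows "diagonal_overlap A (l 1) = (\<Sum>k=1..N. (norm (left_block l u v k))\<^sup>2)"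
proof -
  let ?T = "schur_mat N l u v" and ?B = "left_block l u v"
  define x where "x = (\<lambda>r. if even r then fst (?B (r div 2 + 1)) else snd (?B (r div 2 + 1)))"
  have x: "x (2 * p) = fst (?B (p + 1))" "x (2 * p + 1) = snd (?B (p + 1))" for p
    by (simp_all add: x_def)
  have T00: "?T $$ (0, 0) = l 1" using schur_mat_index(1)[of 0 N 0 l u v] N by simp
  have "overlap ?T (?T $$ (0, 0)) (?T $$ (0, 0)) = of_real (\<Sum>c<2 * N. (cmod (x c))\<^sup>2)"
  proof (rule overlap_triangular[OF schur_mat_carrier upper_triangular_schur_mat])
    show "distinct (diag_mat ?T)" using nz by (simp add: distinct_diag_schur_mat_iff)
    show "x 0 = 1" using x(1)[of 0] by (simp add: left_block.simps)
    fix w c assume "\<And>c. c < 2 * N \<Longrightarrow> (\<Sum>r<2 * N. w r * ?T $$ (r, c)) = ?T $$ (0, 0) * w c"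
      and c: "c < 2 * N"
    then have ev: "\<And>c. c < 2 * N \<Longrightarrow> (\<Sum>r<2 * N. w r * ?T $$ (r, c)) = l 1 * w c" by (simp only: T00)
    show "w c = w 0 * x c"
      by (cases rule: even_odd_cases[OF c]; hypsubst; unfold x; rule schur_left_eigenvector[OF nz ev]; assumption)
  qed (use N in simp)
  also have "(\<Sum>c<2 * N. (cmod (x c))\<^sup>2) = (\<Sum>p<N. (norm (?B (p + 1)))\<^sup>2)"
    unfolding sum_even_odd x by (simp add: norm_prod_def)
  also have "\<dots> = (\<Sum>k=1..N. (norm (?B k))\<^sup>2)"
    by (rule sum.reindex_bij_witness[of _ "\<lambda>i. i - 1" Suc]) auto
  finally show ?thesis
    unfolding diagonal_overlap_def overlap_unitarily_equivalent[OF A] T00 by simp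
qed

text \<open>This is the default value of \<^const>\<open>overlap\<close>; it makes the overlap a measurable function of
the Schur form without exceptional points.\<close>

lemma diagonal_overlap_degenerate:
  assumes A: "unitarily_equivalent A (schur_mat N l u v)" and z: "eigenvalue_weight N l = 0"
  shows "diagonal_overlap A a = 0"
proof -
  let ?T = "schur_mat N l u v"
  have "card (spectrum ?T) \<noteq> dim_row ?T"
  proof
    assume "card (spectrum ?T) = dim_row ?T"
    then have "card (set (diag_mat ?T)) = length (diag_mat ?T)"
      by (simp add: spectrum_upper_triangular[OF schur_mat_carrier upper_triangular_schur_mat] diag_mat_def)
    then have "distinct (diag_mat ?T)" by (rule card_distinct)
    then show False using z by (simp add: distinct_diag_schur_mat_iff)
  qed
  then show ?thesis
    unfolding diagonal_overlap_def overlap_unitarily_equivalent[OF A] by (simp add: overlap_def)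
qed

text \<open>The left eigenvector does not change when the matrix is multiplied by a non-zero scalar.\<close>

lemma left_block_scale:
  fixes s :: real
  assumes s: "s \<noteq> 0"
  shows "left_block l (\<lambda>i j. u i j / of_real s) (\<lambda>i j. v i j / of_real s) k =
    left_block (\<lambda>i. of_real s * l i) u v k"
proof (induction k rule: less_induct)
  case (less k)
  show ?case
  proof (cases "k \<le> 1")
    case False
    let ?B = "left_block (\<lambda>i. of_real s * l i) u v"
    have q: "quat_mult b (x / of_real s, y / of_real s) =
        (fst (quat_mult b (x, y)) / of_real s, snd (quat_mult b (x, y)) / of_real s)" for b x y
      by (simp add: quat_mult_def diff_divide_distrib add_divide_distrib)
    have "(\<Sum>i\<in>{1..<k}. quat_mult (left_block l (\<lambda>i j. u i j / of_real s) (\<lambda>i j. v i j / of_real s) i)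
        (u i k / of_real s, v i k / of_real s)) =
      (\<Sum>i\<in>{1..<k}. (fst (quat_mult (?B i) (u i k, v i k)) / of_real s, snd (quat_mult (?B i) (u i k, v i k)) / of_real s))"
      by (intro sum.cong refl) (simp only: less.IH atLeastLessThan_iff q)
    also have "\<dots> = (fst (\<Sum>i\<in>{1..<k}. quat_mult (?B i) (u i k, v i k)) / of_real s,
        snd (\<Sum>i\<in>{1..<k}. quat_mult (?B i) (u i k, v i k)) / of_real s)"
      by (rule prod_eqI) (simp_all add: fst_sum snd_sum sum_divide_distrib)
    finally show ?thesis
      unfolding left_block.simps[of _ _ _ k] using False
      by (simp add: Let_def flip: right_diff_distrib)
  qed (simp add: left_block.simps)
qed

lemma smult_schur_mat:
  fixes s :: real
  assumes s: "s \<noteq> 0"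
  shows "of_real (1 / s) \<cdot>\<^sub>m schur_mat N (\<lambda>i. of_real s * l i) u v =
    schur_mat N l (\<lambda>i j. u i j / of_real s) (\<lambda>i j. v i j / of_real s)"
proof (rule eq_matI)
  let ?L = "of_real (1 / s) \<cdot>\<^sub>m schur_mat N (\<lambda>i. of_real s * l i) u v"
    and ?R = "schur_mat N l (\<lambda>i j. u i j / of_real s) (\<lambda>i j. v i j / of_real s)"
  fix r c assume "r < dim_row ?R" "c < dim_col ?R"
  then have r: "r < 2 * N" and c: "c < 2 * N"
    using schur_mat_carrier[of N l "\<lambda>i j. u i j / of_real s" "\<lambda>i j. v i j / of_real s"] by auto
  show "?L $$ (r, c) = ?R $$ (r, c)"
    by (cases rule: even_odd_cases[OF r]; cases rule: even_odd_cases[OF c])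
       (use s schur_mat_carrier[of N "\<lambda>i. of_real s * l i" u v] in \<open>auto simp: schur_mat_index[simplified]\<close>)
qed (use schur_mat_carrier[of N "\<lambda>i. of_real s * l i" u v]
      schur_mat_carrier[of N l "\<lambda>i j. u i j / of_real s" "\<lambda>i j. v i j / of_real s"] in auto)

lemma diagonal_overlap_scaled:
  fixes s :: real
  assumes N: "N \<ge> 1" and s: "s \<noteq> 0"
    and A: "unitarily_equivalent A (schur_mat N (\<lambda>i. of_real s * l i) u v)"
  shows "diagonal_overlap (of_real (1 / s) \<cdot>\<^sub>m A) (l 1) = (if eigenvalue_weight N l = 0 then 0
    else \<Sum>k=1..N. (norm (left_block (\<lambda>i. of_real s * l i) u v k))\<^sup>2)"
proof -
  have "unitarily_equivalent (of_real (1 / s) \<cdot>\<^sub>m A)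
      (schur_mat N l (\<lambda>i j. u i j / of_real s) (\<lambda>i j. v i j / of_real s))"
    using A similar_mat_wit_smult unfolding unitarily_equivalent_def smult_schur_mat[OF s, symmetric] by blast
  then show ?thesis
    using diagonal_overlap_schur_mat[OF N] diagonal_overlap_degenerate
    by (simp add: left_block_scale[OF s])
qed

lemma eigenvalue_weight_scale_eq_0_iff:
  fixes s :: real
  assumes "s \<noteq> 0"
  shows "eigenvalue_weight N (\<lambda>i\<in>{1..N}. of_real s * l i) = 0 \<longleftrightarrow> eigenvalue_weight N l = 0"
proof -
  have "eigenvalue_weight N (\<lambda>i\<in>{1..N}. of_real s * l i) \<noteq> 0 \<longleftrightarrow> eigenvalue_weight N l \<noteq> 0"
    unfolding eigenvalue_weight_nonzero_iff
    by (intro arg_cong2[where f = "(\<and>)"] all_cong1 imp_cong refl) (use assms in auto)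
  then show ?thesis by blast
qed

lemma eigenvalue_weight_restrict: "eigenvalue_weight N (\<lambda>i\<in>{1..N}. l i) = eigenvalue_weight N l"
  unfolding eigenvalue_weight_def
  by (intro arg_cong2[where f = "(*)"] prod.cong refl) auto

section \<open>Isotropic Gaussian measures\<close>

text \<open>The law of a vector whose coordinates are independent real normal variables of variance \<open>1/2\<close>.  In
one complex dimension it is the standard complex Gaussian measure; the general dimension allows
pairs of complex numbers to be treated as vectors.\<close>

definition iso_gaussian :: "'a::euclidean_space measure" where
  "iso_gaussian = density lborel (\<lambda>x. ennreal (exp (- (norm x)\<^sup>2) / sqrt pi ^ DIM('a)))"

lemma nn_integral_lborel_affine:
  fixes f :: "'a::euclidean_space \<Rightarrow> ennreal"
  assumes [measurable]: "f \<in> borel_measurable borel" and c: "c \<noteq> 0"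
  shows "(\<integral>\<^sup>+x. f x \<partial>lborel) = ennreal (\<bar>c\<bar> ^ DIM('a)) * (\<integral>\<^sup>+x. f (t + c *\<^sub>R x) \<partial>lborel)"
  by (subst lborel_affine[OF c, of t])
     (simp add: nn_integral_density nn_integral_distr nn_integral_cmult)

lemma nn_integral_exp_square_real: "(\<integral>\<^sup>+x. ennreal (exp (- (x::real)\<^sup>2)) \<partial>lborel) = ennreal (sqrt pi)"
proof -
  interpret prob_space "density lborel (\<lambda>x. ennreal (normal_density 0 (sqrt (1/2)) x))"
    by (rule prob_space_normal_density) simp
  have "(\<integral>\<^sup>+x. ennreal (exp (- (x::real)\<^sup>2)) \<partial>lborel)
      = (\<integral>\<^sup>+x. ennreal (sqrt pi) * ennreal (normal_density 0 (sqrt (1/2)) x) \<partial>lborel)"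
    by (intro nn_integral_cong) (simp add: normal_density_def ennreal_mult'[symmetric])
  also have "\<dots> = ennreal (sqrt pi) * (\<integral>\<^sup>+x. ennreal (normal_density 0 (sqrt (1/2)) x) \<partial>lborel)"
    by (rule nn_integral_cmult) simp
  also have "(\<integral>\<^sup>+x. ennreal (normal_density 0 (sqrt (1/2)) x) \<partial>lborel) = 1"
    using emeasure_space_1 by (simp add: emeasure_density)
  finally show ?thesis by simp
qed

lemma nn_integral_square_exp_square_real:
  "(\<integral>\<^sup>+x. ennreal ((x::real)\<^sup>2 * exp (- x\<^sup>2)) \<partial>lborel) = ennreal (sqrt pi / 2)"
proof -
  have "has_bochner_integral lborel (\<lambda>x. normal_density 0 (sqrt (1/2)) x * (x - 0) ^ (2 * 1))
          (fact (2 * 1) / ((2 / (sqrt (1/2))\<^sup>2) ^ 1 * fact 1))"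
    by (rule normal_moment_even) simp
  then have "has_bochner_integral lborel (\<lambda>x. normal_density 0 (sqrt (1/2)) x * x\<^sup>2) (1/2)"
    by (simp add: fact_numeral)
  then have "integrable lborel (\<lambda>x. normal_density 0 (sqrt (1/2)) x * x\<^sup>2)"
    and "(\<integral>x. normal_density 0 (sqrt (1/2)) x * x\<^sup>2 \<partial>lborel) = 1/2"
    by (simp_all only: has_bochner_integral_iff)
  then have "(\<integral>\<^sup>+x. ennreal (normal_density 0 (sqrt (1/2)) x * x\<^sup>2) \<partial>lborel) = ennreal (1/2)"
    by (subst nn_integral_eq_integral)
       (auto simp only: intro!: AE_I2 mult_nonneg_nonneg normal_density_nonneg zero_le_power2)
  then have "ennreal (sqrt pi) * (\<integral>\<^sup>+x. ennreal (normal_density 0 (sqrt (1/2)) x * x\<^sup>2) \<partial>lborel)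
     = ennreal (sqrt pi / 2)"
    by (simp only: ennreal_mult'[symmetric] pi_ge_zero real_sqrt_ge_zero) simp
  then have "(\<integral>\<^sup>+x. ennreal (sqrt pi) * ennreal (normal_density 0 (sqrt (1/2)) x * x\<^sup>2) \<partial>lborel)
     = ennreal (sqrt pi / 2)"
    by (subst nn_integral_cmult) simp_all
  also have "(\<integral>\<^sup>+x. ennreal (sqrt pi) * ennreal (normal_density 0 (sqrt (1/2)) x * x\<^sup>2) \<partial>lborel) =
     (\<integral>\<^sup>+x. ennreal ((x::real)\<^sup>2 * exp (- x\<^sup>2)) \<partial>lborel)"
    by (intro nn_integral_cong) (simp add: normal_density_def ennreal_mult'[symmetric])
  finally show ?thesis .
qed

lemma nn_integral_exp_norm_square:
  "(\<integral>\<^sup>+x. ennreal (exp (- (norm (x::'a::euclidean_space))\<^sup>2)) \<partial>lborel) = ennreal (sqrt pi ^ DIM('a))"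
proof -
  have "(\<integral>\<^sup>+x. ennreal (exp (- (norm (x::'a))\<^sup>2)) \<partial>lborel)
      = (\<integral>\<^sup>+x. (\<Prod>b\<in>Basis. ennreal (exp (- ((x::'a) \<bullet> b)\<^sup>2))) \<partial>lborel)"
  proof (intro nn_integral_cong)
    fix x :: 'a
    have "(norm x)\<^sup>2 = (\<Sum>b\<in>Basis. (x \<bullet> b)\<^sup>2)"
      using euclidean_inner[of x x] by (simp add: power2_norm_eq_inner) (simp add: power2_eq_square)
    then show "ennreal (exp (- (norm x)\<^sup>2)) = (\<Prod>b\<in>Basis. ennreal (exp (- (x \<bullet> b)\<^sup>2)))"
      by (simp add: prod_ennreal exp_sum[symmetric] sum_negf)
  qed
  also have "\<dots> = (\<Prod>b\<in>(Basis::'a set). \<integral>\<^sup>+x. ennreal (exp (- x\<^sup>2)) \<partial>lborel)"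
    by (rule nn_integral_lborel_prod) simp_all
  also have "\<dots> = ennreal (sqrt pi ^ DIM('a))"
    by (simp add: nn_integral_exp_square_real ennreal_power)
  finally show ?thesis .
qed

lemma nn_integral_iso_gaussian:
  fixes f :: "'a::euclidean_space \<Rightarrow> ennreal"
  assumes [measurable]: "f \<in> borel_measurable borel"
  shows "(\<integral>\<^sup>+x. f x \<partial>iso_gaussian) =
    ennreal (1 / sqrt pi ^ DIM('a)) * (\<integral>\<^sup>+x. ennreal (exp (- (norm x)\<^sup>2)) * f x \<partial>lborel)"
proof -
  have "(\<integral>\<^sup>+x. f x \<partial>iso_gaussian) =
      (\<integral>\<^sup>+x. ennreal (1 / sqrt pi ^ DIM('a)) * (ennreal (exp (- (norm x)\<^sup>2)) * f x) \<partial>lborel)"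
    unfolding iso_gaussian_def
    by (subst nn_integral_density)
       (auto intro!: nn_integral_cong simp: mult.assoc[symmetric] ennreal_mult'[symmetric])
  then show ?thesis by (simp add: nn_integral_cmult)
qed

lemma sets_iso_gaussian[simp, measurable_cong]: "sets (iso_gaussian :: 'a::euclidean_space measure) = sets borel"
  and space_iso_gaussian[simp]: "space (iso_gaussian :: 'a::euclidean_space measure) = UNIV"
  by (simp_all add: iso_gaussian_def)

lemma prob_space_iso_gaussian: "prob_space (iso_gaussian :: 'a::euclidean_space measure)"
proof
  have "emeasure (iso_gaussian :: 'a measure) UNIV = (\<integral>\<^sup>+x. 1 \<partial>(iso_gaussian :: 'a measure))"
    by simp
  also have "\<dots> = 1"
    by (subst nn_integral_iso_gaussian)
       (simp_all add: nn_integral_exp_norm_square ennreal_mult'[symmetric])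
  finally show "emeasure (iso_gaussian :: 'a measure) (space iso_gaussian) = 1" by simp
qed

lemma iso_gaussian_prod:
  "(iso_gaussian :: 'a::euclidean_space measure) \<Otimes>\<^sub>M (iso_gaussian :: 'b::euclidean_space measure) = iso_gaussian"
proof -
  interpret A: prob_space "iso_gaussian :: 'a measure" by (rule prob_space_iso_gaussian)
  interpret B: prob_space "iso_gaussian :: 'b measure" by (rule prob_space_iso_gaussian)
  have "(iso_gaussian :: 'a measure) \<Otimes>\<^sub>M (iso_gaussian :: 'b measure)
     = density (lborel \<Otimes>\<^sub>M lborel) (\<lambda>(x, y). ennreal (exp (- (norm x)\<^sup>2) / sqrt pi ^ DIM('a)) *
         ennreal (exp (- (norm y)\<^sup>2) / sqrt pi ^ DIM('b)))"
    unfolding iso_gaussian_def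
    by (rule pair_measure_density)
       (auto intro!: lborel.sigma_finite_measure_axioms B.sigma_finite_measure_axioms[unfolded iso_gaussian_def])
  also have "\<dots> = density (lborel :: ('a \<times> 'b) measure)
      (\<lambda>x. ennreal (exp (- (norm x)\<^sup>2) / sqrt pi ^ DIM('a \<times> 'b)))"
    unfolding lborel_prod
    by (intro arg_cong[where f = "density lborel"] ext)
       (auto simp: norm_Pair power_add ennreal_mult'[symmetric] mult_exp_exp)
  finally show ?thesis unfolding iso_gaussian_def .
qed

text \<open>For independent \<open>x, y\<close> with law \<^const>\<open>iso_gaussian\<close>, the vector \<open>a x + A y\<close> has the law of
\<open>r x\<close> with \<open>r\<^sup>2 = a\<^sup>2 + t\<^sup>2\<close> when \<open>A\<close> is a similarity with factor \<open>t\<close>.  With \<open>p = a x + A y\<close> as a new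
variable in place of \<open>x\<close>, completing the square in \<open>y\<close> gives
\<open>|p - A y|\<^sup>2 / a\<^sup>2 + |y|\<^sup>2 = |p|\<^sup>2 / r\<^sup>2 + (r\<^sup>2 / a\<^sup>2) |y - B p / r\<^sup>2|\<^sup>2\<close> with the adjoint \<open>B\<close> of \<open>A\<close>, so
that \<open>y\<close> can be integrated out.  Both substitutions are translations and scalings of Lebesgue
measure; the first one divides by \<open>a\<close>.\<close>

lemma iso_gaussian_conformal_sum:
  fixes A B :: "'a::euclidean_space \<Rightarrow> 'a"
  assumes a: "a > 0" and t: "t \<ge> 0"
    and f[measurable]: "f \<in> borel_measurable borel"
    and A[measurable]: "A \<in> borel_measurable borel"
    and adj: "\<And>x y. inner (A x) y = inner x (B y)"
    and nA: "\<And>x. norm (A x) = t * norm x" and nB: "\<And>x. norm (B x) = t * norm x"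
  shows "(\<integral>\<^sup>+x. \<integral>\<^sup>+y. f (a *\<^sub>R x + A y) \<partial>iso_gaussian \<partial>iso_gaussian) =
         (\<integral>\<^sup>+x. f (sqrt (a\<^sup>2 + t\<^sup>2) *\<^sub>R x) \<partial>iso_gaussian)"
proof -
  define r where "r = sqrt (a\<^sup>2 + t\<^sup>2)"
  define n where "n = DIM('a)"
  define C where "C = ennreal (1 / sqrt pi ^ n)"
  have r: "r > 0" "r\<^sup>2 = a\<^sup>2 + t\<^sup>2" using a by (simp_all add: r_def add_pos_nonneg)
  note G = nn_integral_iso_gaussian[where 'a='a, folded n_def, folded C_def]
  let ?e = "\<lambda>x::'a. ennreal (exp (- (norm x)\<^sup>2))"
  have "(\<integral>\<^sup>+x. \<integral>\<^sup>+y. f (a *\<^sub>R x + A y) \<partial>iso_gaussian \<partial>iso_gaussian) =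
     C * (C * (\<integral>\<^sup>+x. \<integral>\<^sup>+y. ?e x * (?e y * f (a *\<^sub>R x + A y)) \<partial>lborel \<partial>lborel))"
    by (simp add: G nn_integral_cmult mult.left_commute)
  also have "(\<integral>\<^sup>+x. \<integral>\<^sup>+y. ?e x * (?e y * f (a *\<^sub>R x + A y)) \<partial>lborel \<partial>lborel) =
     (\<integral>\<^sup>+y. \<integral>\<^sup>+x. ?e x * (?e y * f (a *\<^sub>R x + A y)) \<partial>lborel \<partial>lborel)"
    by (rule lborel_pair.Fubini'[symmetric]) measurable
  \<comment> \<open>for fixed \<open>y\<close> the new variable is the argument of \<open>f\<close>\<close>
  also have "\<dots> = (\<integral>\<^sup>+y. ennreal ((1/a) ^ n) *
        (\<integral>\<^sup>+p. ?e ((1/a) *\<^sub>R (p - A y)) * (?e y * f p) \<partial>lborel) \<partial>lborel)"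
  proof (rule nn_integral_cong)
    fix y :: 'a
    show "(\<integral>\<^sup>+x. ?e x * (?e y * f (a *\<^sub>R x + A y)) \<partial>lborel) = ennreal ((1/a) ^ n) *
        (\<integral>\<^sup>+p. ?e ((1/a) *\<^sub>R (p - A y)) * (?e y * f p) \<partial>lborel)"
      using a by (subst nn_integral_lborel_affine[where c = "1/a" and t = "- (1/a) *\<^sub>R A y"])
         (auto simp: n_def algebra_simps)
  qed
  also have "\<dots> = ennreal ((1/a) ^ n) *
      (\<integral>\<^sup>+y. \<integral>\<^sup>+p. ?e ((1/a) *\<^sub>R (p - A y)) * (?e y * f p) \<partial>lborel \<partial>lborel)"
    by (rule nn_integral_cmult) measurable
  also have "(\<integral>\<^sup>+y. \<integral>\<^sup>+p. ?e ((1/a) *\<^sub>R (p - A y)) * (?e y * f p) \<partial>lborel \<partial>lborel) =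
      (\<integral>\<^sup>+p. \<integral>\<^sup>+y. ?e ((1/a) *\<^sub>R (p - A y)) * (?e y * f p) \<partial>lborel \<partial>lborel)"
    by (rule lborel_pair.Fubini') measurable
  also have "\<dots> = (\<integral>\<^sup>+p. (?e ((1/r) *\<^sub>R p) * f p) * ennreal ((a/r) ^ n * sqrt pi ^ n) \<partial>lborel)"
  proof (rule nn_integral_cong)
    fix p :: 'a
    \<comment> \<open>the centre of the completed square in the variable \<open>y\<close>\<close>
    define m where "m = (1 / r\<^sup>2) *\<^sub>R B p"
    have sq: "(norm ((1/a) *\<^sub>R (p - A y)))\<^sup>2 + (norm y)\<^sup>2 =
        (norm ((1/r) *\<^sub>R p))\<^sup>2 + (norm ((r/a) *\<^sub>R (y - m)))\<^sup>2" for y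
    proof -
      have c: "inner p (A y) = inner y (B p)"
        by (simp only: adj inner_commute[of p])
      have "(norm (p - A y))\<^sup>2 = (norm p)\<^sup>2 - 2 * (inner p (A y)) + (norm (A y))\<^sup>2"
        by (simp add: power2_norm_eq_inner inner_diff inner_commute)
      then have "(norm (p - A y))\<^sup>2 = (norm p)\<^sup>2 - 2 * (inner y (B p)) + t\<^sup>2 * (norm y)\<^sup>2"
        by (simp add: c nA power_mult_distrib)
      moreover have "(norm (y - m))\<^sup>2 = (norm y)\<^sup>2 - 2 * (inner y (B p)) / r\<^sup>2 + (norm (B p))\<^sup>2 / (r\<^sup>2)\<^sup>2"
        unfolding power2_norm_eq_inner m_def
        by (simp add: inner_diff inner_commute power2_eq_square)
      then have "(norm (y - m))\<^sup>2 = (norm y)\<^sup>2 - 2 * (inner y (B p)) / r\<^sup>2 + t\<^sup>2 * (norm p)\<^sup>2 / (r\<^sup>2)\<^sup>2"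
        by (simp add: nB power_mult_distrib)
      moreover have "(P - 2 * b + s * Y) / \<alpha> + Y = P / \<rho> + \<rho> / \<alpha> * (Y - 2 * b / \<rho> + s * P / \<rho>\<^sup>2)"
        if "\<alpha> > 0" "\<rho> > 0" "s = \<rho> - \<alpha>" for P b s Y \<alpha> \<rho> :: real
        using that(1,2) unfolding that(3) by (simp add: divide_simps power2_eq_square) (simp add: algebra_simps)
      from this[of "a\<^sup>2" "r\<^sup>2" "t\<^sup>2" "(norm p)\<^sup>2" "inner y (B p)" "(norm y)\<^sup>2"] have
        "((norm p)\<^sup>2 - 2 * (inner y (B p)) + t\<^sup>2 * (norm y)\<^sup>2) / a\<^sup>2 + (norm y)\<^sup>2 =
         (norm p)\<^sup>2 / r\<^sup>2 + r\<^sup>2 / a\<^sup>2 * ((norm y)\<^sup>2 - 2 * (inner y (B p)) / r\<^sup>2 + t\<^sup>2 * (norm p)\<^sup>2 / (r\<^sup>2)\<^sup>2)"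
        using a r(1) r(2) by (metis add_diff_cancel_left' zero_less_power)
      ultimately show ?thesis
        by (simp add: power_mult_distrib power_divide)
    qed
    have "(\<integral>\<^sup>+y. ?e ((1/a) *\<^sub>R (p - A y)) * (?e y * f p) \<partial>lborel) =
        (\<integral>\<^sup>+y. (?e ((1/r) *\<^sub>R p) * f p) * ?e ((r/a) *\<^sub>R (y - m)) \<partial>lborel)"
    proof (rule nn_integral_cong)
      fix y
      have "?e ((1/a) *\<^sub>R (p - A y)) * ?e y = ?e ((1/r) *\<^sub>R p) * ?e ((r/a) *\<^sub>R (y - m))"
        using sq[of y] by (simp add: ennreal_mult'[symmetric] mult_exp_exp)
      then have "?e ((1/a) *\<^sub>R (p - A y)) * ?e y * f p = ?e ((1/r) *\<^sub>R p) * ?e ((r/a) *\<^sub>R (y - m)) * f p"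
        by (simp only:)
      then show "?e ((1/a) *\<^sub>R (p - A y)) * (?e y * f p) = (?e ((1/r) *\<^sub>R p) * f p) * ?e ((r/a) *\<^sub>R (y - m))"
        by (simp only: mult.assoc mult.commute[of "f p"])
    qed
    also have "\<dots> = (?e ((1/r) *\<^sub>R p) * f p) * (\<integral>\<^sup>+y. ?e ((r/a) *\<^sub>R (y - m)) \<partial>lborel)"
      by (rule nn_integral_cmult) measurable
    also have "(\<integral>\<^sup>+y. ?e ((r/a) *\<^sub>R (y - m)) \<partial>lborel) = ennreal ((a/r) ^ n * sqrt pi ^ n)"
      using a r(1) by (subst nn_integral_lborel_affine[where c = "a/r" and t = m])
         (simp_all add: n_def nn_integral_exp_norm_square ennreal_mult'[symmetric])
    finally show "(\<integral>\<^sup>+y. ?e ((1/a) *\<^sub>R (p - A y)) * (?e y * f p) \<partial>lborel) =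
      (?e ((1/r) *\<^sub>R p) * f p) * ennreal ((a/r) ^ n * sqrt pi ^ n)" .
  qed
  also have "\<dots> = (\<integral>\<^sup>+p. ?e ((1/r) *\<^sub>R p) * f p \<partial>lborel) * ennreal ((a/r) ^ n * sqrt pi ^ n)"
    by (rule nn_integral_multc) measurable
  also have "(\<integral>\<^sup>+p. ?e ((1/r) *\<^sub>R p) * f p \<partial>lborel) = ennreal (r ^ n) * (\<integral>\<^sup>+x. ?e x * f (r *\<^sub>R x) \<partial>lborel)"
    using r(1) by (subst nn_integral_lborel_affine[where c = r and t = 0]) (simp_all add: n_def)
  also have "C * (C * (ennreal ((1/a) ^ n) * ((ennreal (r ^ n) * (\<integral>\<^sup>+x. ?e x * f (r *\<^sub>R x) \<partial>lborel)) *
       ennreal ((a/r) ^ n * sqrt pi ^ n)))) =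
     (C * ennreal ((1/a) ^ n) * ennreal (r ^ n) * ennreal ((a/r) ^ n * sqrt pi ^ n)) *
       (C * (\<integral>\<^sup>+x. ?e x * f (r *\<^sub>R x) \<partial>lborel))"
    by (simp only: ac_simps)
  also have "C * ennreal ((1/a) ^ n) * ennreal (r ^ n) * ennreal ((a/r) ^ n * sqrt pi ^ n) = 1"
    using a r(1) unfolding C_def by (simp add: ennreal_mult'[symmetric] power_divide)
  finally show ?thesis
    unfolding r_def[symmetric] by (subst (2) G) simp_all
qed

text \<open>Write \<open>|z|\<^sup>2 = (Re z)\<^sup>2 + (Im z)\<^sup>2\<close>; each summand splits into one-dimensional integrals.\<close>

lemma nn_integral_cmod_square_gaussian: "(\<integral>\<^sup>+z. ennreal ((cmod z)\<^sup>2) \<partial>iso_gaussian) = 1"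
proof -
  let ?g = "\<lambda>k x :: real. x ^ k * exp (- x\<^sup>2)"
  have moment: "(\<integral>\<^sup>+z. ennreal (?g j (Re z) * ?g k (Im z)) \<partial>lborel) =
      (\<integral>\<^sup>+x. ennreal (?g j x) \<partial>lborel) * (\<integral>\<^sup>+x. ennreal (?g k x) \<partial>lborel)" if "even j" "even k" for j k
  proof -
    define f where "f = (\<lambda>b :: complex. \<lambda>x. ennreal (if b = 1 then ?g j x else ?g k x))"
    have "(\<integral>\<^sup>+z. (\<Prod>b\<in>Basis. f b (inner z b)) \<partial>lborel) = (\<Prod>b\<in>Basis. (\<integral>\<^sup>+x. f b x \<partial>lborel))"
      unfolding f_def by (rule nn_integral_lborel_prod) auto
    then show ?thesis
      using that by (simp add: f_def Basis_complex_def ennreal_mult'[symmetric] zero_le_even_power cong: if_cong)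
  qed
  have "(\<integral>\<^sup>+z. ennreal ((cmod z)\<^sup>2) \<partial>iso_gaussian) =
      ennreal (1 / pi) * (\<integral>\<^sup>+z. ennreal (exp (- (cmod z)\<^sup>2)) * ennreal ((cmod z)\<^sup>2) \<partial>lborel)"
    by (subst nn_integral_iso_gaussian) simp_all
  also have "(\<integral>\<^sup>+z. ennreal (exp (- (cmod z)\<^sup>2)) * ennreal ((cmod z)\<^sup>2) \<partial>lborel) =
      (\<integral>\<^sup>+z. ennreal (?g 2 (Re z) * ?g 0 (Im z)) + ennreal (?g 0 (Re z) * ?g 2 (Im z)) \<partial>lborel)"
  proof (intro nn_integral_cong)
    fix z :: complex
    have "exp (- (cmod z)\<^sup>2) = exp (- (Re z)\<^sup>2) * exp (- (Im z)\<^sup>2)"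
      by (simp add: cmod_power2 mult_exp_exp)
    then have "exp (- (cmod z)\<^sup>2) * (cmod z)\<^sup>2 = ?g 2 (Re z) * ?g 0 (Im z) + ?g 0 (Re z) * ?g 2 (Im z)"
      by (simp only:) (simp add: cmod_power2 algebra_simps)
    then show "ennreal (exp (- (cmod z)\<^sup>2)) * ennreal ((cmod z)\<^sup>2) =
        ennreal (?g 2 (Re z) * ?g 0 (Im z)) + ennreal (?g 0 (Re z) * ?g 2 (Im z))"
      by (simp add: ennreal_mult'[symmetric] flip: ennreal_plus)
  qed
  also have "\<dots> = (\<integral>\<^sup>+z. ennreal (?g 2 (Re z) * ?g 0 (Im z)) \<partial>lborel) + (\<integral>\<^sup>+z. ennreal (?g 0 (Re z) * ?g 2 (Im z)) \<partial>lborel)"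
    by (rule nn_integral_add) measurable
  also have "\<dots> = (\<integral>\<^sup>+x. ennreal (?g 2 x) \<partial>lborel) * (\<integral>\<^sup>+x. ennreal (?g 0 x) \<partial>lborel) +
      (\<integral>\<^sup>+x. ennreal (?g 0 x) \<partial>lborel) * (\<integral>\<^sup>+x. ennreal (?g 2 x) \<partial>lborel)"
    by (intro arg_cong2[where f = "(+)"] moment) simp_all
  also have "\<dots> = ennreal pi"
    by (simp add: nn_integral_exp_square_real nn_integral_square_exp_square_real ennreal_mult'[symmetric] flip: ennreal_plus)
  finally show ?thesis by (simp add: ennreal_mult'[symmetric])
qed

section \<open>Products of complex Gaussian measures\<close>

lemma sigma_finite_iso_gaussian: "sigma_finite_measure (iso_gaussian :: 'a::euclidean_space measure)"
  by (rule prob_space_imp_sigma_finite[OF prob_space_iso_gaussian])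

lemma std_complex_gaussian_eq_iso: "std_complex_gaussian = iso_gaussian"
  unfolding std_complex_gaussian_def iso_gaussian_def by simp

interpretation gaussian_product: product_sigma_finite "\<lambda>_::'i. std_complex_gaussian"
  unfolding std_complex_gaussian_eq_iso product_sigma_finite_def by (intro allI sigma_finite_iso_gaussian)

lemma sets_std_complex_gaussian [simp, measurable_cong]: "sets std_complex_gaussian = sets borel"
  by (simp add: std_complex_gaussian_def)

lemma iid_std_complex_gaussian_measurable:
  assumes "prob_space M" "iid_std_complex_gaussian M I X" "i \<in> I"
  shows "X i \<in> borel_measurable M"
proof -
  interpret prob_space M by fact
  show ?thesis using assms(2,3) by (auto simp: iid_std_complex_gaussian_def indep_vars_def)
qed

lemma iid_std_complex_gaussian_distr:
  assumes M: "prob_space M" and X: "iid_std_complex_gaussian M I X"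
  shows "distr M (\<Pi>\<^sub>M i\<in>I. borel) (\<lambda>\<omega>. \<lambda>i\<in>I. X i \<omega>) = (\<Pi>\<^sub>M i\<in>I. std_complex_gaussian)"
proof (cases "I = {}")
  case True
  interpret prob_space M by fact
  have "(\<lambda>\<omega>. \<lambda>i\<in>I. X i \<omega>) = (\<lambda>_. \<lambda>_. undefined)" using True by (simp add: fun_eq_iff)
  then show ?thesis
    unfolding True PiM_empty
    by (intro measure_eqI) (auto simp: emeasure_distr subset_singleton_iff emeasure_space_1 dest!: subset_singletonD)
next
  case False
  interpret prob_space M by fact
  have "distr M (\<Pi>\<^sub>M i\<in>I. borel) (\<lambda>\<omega>. \<lambda>i\<in>I. X i \<omega>) = (\<Pi>\<^sub>M i\<in>I. distr M borel (X i))"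
    using X indep_vars_iff_distr_eq_PiM'[OF False, where M' = "\<lambda>_. borel" and X = X]
      iid_std_complex_gaussian_measurable[OF M X]
    by (auto simp: iid_std_complex_gaussian_def)
  also have "\<dots> = (\<Pi>\<^sub>M i\<in>I. std_complex_gaussian)"
    using X by (intro PiM_cong refl) (simp add: iid_std_complex_gaussian_def)
  finally show ?thesis .
qed

text \<open>A variable and its partner in the other family are integrated together, as one vector of
\<^typ>\<open>complex \<times> complex\<close>.\<close>

lemma nn_integral_PiM_insert_pair:
  fixes f :: "('a + 'b \<Rightarrow> complex) \<Rightarrow> ennreal"
  assumes I: "finite I" "Inl a \<notin> I" "Inr b \<notin> I"
    and f[measurable]: "f \<in> borel_measurable (\<Pi>\<^sub>M i\<in>insert (Inl a) (insert (Inr b) I). std_complex_gaussian)"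
  shows "(\<integral>\<^sup>+x. f x \<partial>(\<Pi>\<^sub>M i\<in>insert (Inl a) (insert (Inr b) I). std_complex_gaussian)) =
    (\<integral>\<^sup>+x. \<integral>\<^sup>+p. f (x(Inr b := snd p, Inl a := fst p)) \<partial>iso_gaussian \<partial>(\<Pi>\<^sub>M i\<in>I. std_complex_gaussian))"
proof -
  interpret S: pair_sigma_finite "std_complex_gaussian" "std_complex_gaussian"
    unfolding std_complex_gaussian_eq_iso
    by (intro pair_sigma_finite.intro sigma_finite_iso_gaussian)
  let ?P = "\<Pi>\<^sub>M i\<in>I. std_complex_gaussian" and ?P' = "\<Pi>\<^sub>M i\<in>insert (Inr b) I. std_complex_gaussian"
  interpret G: sigma_finite_measure std_complex_gaussian
    unfolding std_complex_gaussian_eq_iso by (rule sigma_finite_iso_gaussian)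
  have "(\<integral>\<^sup>+x. f x \<partial>(\<Pi>\<^sub>M i\<in>insert (Inl a) (insert (Inr b) I). std_complex_gaussian)) =
     (\<integral>\<^sup>+x. \<integral>\<^sup>+u. f (x(Inl a := u)) \<partial>std_complex_gaussian \<partial>?P')"
    using I by (intro gaussian_product.product_nn_integral_insert f) auto
  also have "\<dots> = (\<integral>\<^sup>+x. \<integral>\<^sup>+v. \<integral>\<^sup>+u. f (x(Inr b := v, Inl a := u)) \<partial>std_complex_gaussian \<partial>std_complex_gaussian \<partial>?P)"
    using I by (intro gaussian_product.product_nn_integral_insert) (auto, measurable)
  also have "\<dots> = (\<integral>\<^sup>+x. \<integral>\<^sup>+p. f (x(Inr b := snd p, Inl a := fst p)) \<partial>iso_gaussian \<partial>?P)"
  proof (rule nn_integral_cong)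
    fix x assume "x \<in> space ?P"
    then have [measurable]: "x \<in> space ?P" .
    have m: "(\<lambda>p. f (x(Inr b := snd p, Inl a := fst p))) \<in> borel_measurable (std_complex_gaussian \<Otimes>\<^sub>M std_complex_gaussian)"
      by measurable
    show "(\<integral>\<^sup>+v. \<integral>\<^sup>+u. f (x(Inr b := v, Inl a := u)) \<partial>std_complex_gaussian \<partial>std_complex_gaussian) =
        (\<integral>\<^sup>+p. f (x(Inr b := snd p, Inl a := fst p)) \<partial>iso_gaussian)"
      using S.nn_integral_snd[OF m[folded split_beta']]
      unfolding iso_gaussian_prod[symmetric] std_complex_gaussian_eq_iso by (simp add: split_beta')
  qed
  finally show ?thesis .
qed

lemma borel_measurable_component_gaussian:
  "i \<in> I \<Longrightarrow> (\<lambda>y. y i) \<in> borel_measurable (\<Pi>\<^sub>M i\<in>I. std_complex_gaussian)"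
  using measurable_component_singleton[of i I "\<lambda>_. std_complex_gaussian"]
  by (simp cong: measurable_cong_sets)

lemma norm_quat_mult: "norm (quat_mult p q) = norm p * norm q"
proof -
  have "(norm (quat_mult p q))\<^sup>2 = (norm p * norm q)\<^sup>2"
    unfolding power_mult_distrib
    by (simp add: norm_prod_def quat_mult_def cmod_power2) (simp add: power2_eq_square algebra_simps)
  then show ?thesis by (rule power2_eq_imp_eq) simp_all
qed

lemma norm_quat_conj: "norm (cnj (fst p), - snd p) = norm (p :: complex \<times> complex)"
  by (simp add: norm_prod_def)

lemma quat_mult_adjoint:
  "inner (quat_mult p x) y = inner x (quat_mult (cnj (fst p), - snd p) y)"
  by (cases p; cases x; cases y) (simp add: quat_mult_def inner_complex_def algebra_simps)

lemma borel_measurable_cnj: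
  "f \<in> borel_measurable M \<Longrightarrow> (\<lambda>x. cnj (f x)) \<in> borel_measurable M"
  by (erule measurable_compose, intro borel_measurable_continuous_onI continuous_intros)

lemma borel_measurable_fst_complex:
    "f \<in> borel_measurable M \<Longrightarrow> (\<lambda>x. fst (f x :: complex \<times> complex)) \<in> borel_measurable M"
  and borel_measurable_snd_complex:
    "f \<in> borel_measurable M \<Longrightarrow> (\<lambda>x. snd (f x :: complex \<times> complex)) \<in> borel_measurable M"
  by (erule measurable_compose, intro borel_measurable_continuous_onI continuous_intros)+

lemma borel_measurable_quat_mult[measurable]:
  assumes f: "f \<in> borel_measurable M" and g: "g \<in> borel_measurable M"
  shows "(\<lambda>x. quat_mult (f x) (g x)) \<in> borel_measurable M"
proof -
  show ?thesis unfolding quat_mult_def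
    by (intro borel_measurable_Pair borel_measurable_diff borel_measurable_add borel_measurable_times borel_measurable_cnj
        borel_measurable_fst_complex borel_measurable_snd_complex f g)
qed

text \<open>One column of the Schur form: \<open>y\<close> holds the blocks \<open>T\<^sub>1\<^sub>,\<^sub>c, \<dots>, T\<^sub>m\<^sub>,\<^sub>c\<close>.  The first summand is the block
\<open>T\<^sub>1\<^sub>,\<^sub>c\<close> itself, which has the right law; each further summand is absorbed by
\<open>iso_gaussian_conformal_sum\<close>, whose \<open>a\<close> is positive because of that first summand.\<close>

lemma gaussian_quat_sum:
  fixes f :: "complex \<times> complex \<Rightarrow> ennreal" and b :: "nat \<Rightarrow> complex \<times> complex" and c :: nat
  assumes f: "f \<in> borel_measurable borel" and b1: "b 1 = (1, 0)" and m: "m \<ge> 1"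
  shows "(\<integral>\<^sup>+y. f (\<Sum>i=1..m. quat_mult (b i) (y (Inl (i, c)), y (Inr (i, c))))
       \<partial>(\<Pi>\<^sub>M i\<in>({1..m} \<times> {c}) <+> ({1..m} \<times> {c}). std_complex_gaussian)) =
     (\<integral>\<^sup>+x. f (sqrt (\<Sum>i=1..m. (norm (b i))\<^sup>2) *\<^sub>R x) \<partial>iso_gaussian)"
  using m f
proof (induction m arbitrary: f rule: nat_induct_at_least)
  case base
  note [measurable] = base
  have eq: "({1..1::nat} \<times> {c}) <+> ({1..1::nat} \<times> {c}) = insert (Inl (1, c)) (insert (Inr (1, c)) {})"
    by (simp add: Plus_def insert_commute)
  have q: "quat_mult (1, 0) p = p" for p by (simp add: quat_mult_def)
  show ?case
    unfolding eq
    by (subst nn_integral_PiM_insert_pair)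
       (simp_all add: b1[unfolded One_nat_def] norm_prod_def q PiM_empty nn_integral_count_space_finite)
next
  case (Suc m)
  note [measurable] = Suc.prems
  let ?J = "({1..m} \<times> {c}) <+> ({1..m} \<times> {c})"
  let ?S = "\<lambda>m. \<Sum>i=1..m. (norm (b i))\<^sup>2"
  have eq: "({1..Suc m} \<times> {c}) <+> ({1..Suc m} \<times> {c}) = insert (Inl (Suc m, c)) (insert (Inr (Suc m, c)) ?J)"
    by (auto simp: Plus_def le_Suc_eq image_iff)
  have "?S m \<ge> (\<Sum>i\<in>{1}. (norm (b i))\<^sup>2)" using Suc.hyps by (intro sum_mono2) auto
  then have S: "?S m > 0" using b1 by (simp add: norm_prod_def)
  have fm: "(\<lambda>y. f (\<Sum>i=1..Suc m. quat_mult (b i) (y (Inl (i, c)), y (Inr (i, c)))))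
      \<in> borel_measurable (\<Pi>\<^sub>M i\<in>({1..Suc m} \<times> {c}) <+> ({1..Suc m} \<times> {c}). std_complex_gaussian)"
    by (intro measurable_compose[OF _ Suc.prems] borel_measurable_sum borel_measurable_quat_mult
        borel_measurable_Pair borel_measurable_const borel_measurable_component_gaussian) auto
  have "(\<integral>\<^sup>+y. f (\<Sum>i=1..Suc m. quat_mult (b i) (y (Inl (i, c)), y (Inr (i, c))))
       \<partial>(\<Pi>\<^sub>M i\<in>({1..Suc m} \<times> {c}) <+> ({1..Suc m} \<times> {c}). std_complex_gaussian)) =
     (\<integral>\<^sup>+y. \<integral>\<^sup>+p. f ((\<Sum>i=1..m. quat_mult (b i) (y (Inl (i, c)), y (Inr (i, c)))) + quat_mult (b (Suc m)) p)
       \<partial>iso_gaussian \<partial>(\<Pi>\<^sub>M i\<in>?J. std_complex_gaussian))"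
    unfolding eq using fm[unfolded eq] by (subst nn_integral_PiM_insert_pair) auto
  also have "\<dots> = (\<integral>\<^sup>+x. \<integral>\<^sup>+p. f (sqrt (?S m) *\<^sub>R x + quat_mult (b (Suc m)) p) \<partial>iso_gaussian \<partial>iso_gaussian)"
  proof (rule Suc.IH)
    interpret S: sigma_finite_measure "iso_gaussian :: (complex \<times> complex) measure" by (rule sigma_finite_iso_gaussian)
    show "(\<lambda>s. \<integral>\<^sup>+p. f (s + quat_mult (b (Suc m)) p) \<partial>iso_gaussian) \<in> borel_measurable borel"
      by measurable
  qed
  also have "\<dots> = (\<integral>\<^sup>+x. f (sqrt ((sqrt (?S m))\<^sup>2 + (norm (b (Suc m)))\<^sup>2) *\<^sub>R x) \<partial>iso_gaussian)"
    using S
    by (intro iso_gaussian_conformal_sum[where B = "quat_mult (cnj (fst (b (Suc m))), - snd (b (Suc m)))"])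
       (auto simp: quat_mult_adjoint norm_quat_mult norm_quat_conj)
  also have "(sqrt (?S m))\<^sup>2 + (norm (b (Suc m)))\<^sup>2 = ?S (Suc m)" using S by simp
  finally show ?case .
qed

section \<open>The law of the overlap for given eigenvalues\<close>

lemma left_block_cong:
  assumes "\<And>i. 1 \<le> i \<Longrightarrow> i \<le> k \<Longrightarrow> l i = l' i"
    and "\<And>i j. 1 \<le> i \<Longrightarrow> i < j \<Longrightarrow> j \<le> k \<Longrightarrow> u i j = u' i j"
    and "\<And>i j. 1 \<le> i \<Longrightarrow> i < j \<Longrightarrow> j \<le> k \<Longrightarrow> v i j = v' i j"
  shows "left_block l u v k = left_block l' u' v' k"
  using assms
proof (induction k rule: less_induct)
  case (less k)
  show ?case
  proof (cases "k \<le> 1")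
    case False
    have "(\<Sum>i\<in>{1..<k}. quat_mult (left_block l u v i) (u i k, v i k)) =
        (\<Sum>i\<in>{1..<k}. quat_mult (left_block l' u' v' i) (u' i k, v' i k))"
    proof (intro sum.cong refl)
      fix i assume i: "i \<in> {1..<k}"
      have "left_block l u v i = left_block l' u' v' i"
        using i by (intro less.IH less.prems) auto
      moreover have "u i k = u' i k" "v i k = v' i k" using i by (auto intro: less.prems)
      ultimately show "quat_mult (left_block l u v i) (u i k, v i k) = quat_mult (left_block l' u' v' i) (u' i k, v' i k)"
        by simp
    qed
    moreover have "l 1 = l' 1" "l k = l' k" using False by (auto intro: less.prems)
    ultimately show ?thesis
      unfolding left_block.simps[of l u v k] left_block.simps[of l' u' v' k] by (simp add: Let_def)
  qed (simp add: left_block.simps)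
qed

lemma borel_measurable_left_block:
  assumes l: "\<And>i. 1 \<le> i \<Longrightarrow> i \<le> N \<Longrightarrow> (\<lambda>x. l x i) \<in> borel_measurable M"
    and u: "\<And>i j. 1 \<le> i \<Longrightarrow> i < j \<Longrightarrow> j \<le> N \<Longrightarrow> (\<lambda>x. u x i j) \<in> borel_measurable M"
    and v: "\<And>i j. 1 \<le> i \<Longrightarrow> i < j \<Longrightarrow> j \<le> N \<Longrightarrow> (\<lambda>x. v x i j) \<in> borel_measurable M"
    and k: "k \<le> N"
  shows "(\<lambda>x. left_block (l x) (u x) (v x) k) \<in> borel_measurable M"
  using k
proof (induction k rule: less_induct)
  case (less k)
  show ?case
  proof (cases "k \<le> 1")
    case True
    then show ?thesis by (simp add: left_block.simps)
  next
    case False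
    have S: "(\<lambda>x. \<Sum>i\<in>{1..<k}. quat_mult (left_block (l x) (u x) (v x) i) (u x i k, v x i k)) \<in> borel_measurable M"
      using less.prems
      by (intro borel_measurable_sum borel_measurable_quat_mult borel_measurable_Pair less.IH u v) auto
    have l': "(\<lambda>x. l x 1) \<in> borel_measurable M" "(\<lambda>x. l x k) \<in> borel_measurable M"
      using False less.prems by (auto intro: l)
    show ?thesis
      unfolding left_block.simps[of _ _ _ k] Let_def using False
      by (simp only: if_False)
         (intro borel_measurable_Pair borel_measurable_divide borel_measurable_diff l' borel_measurable_cnj
            borel_measurable_fst_complex[OF S] borel_measurable_snd_complex[OF S])
  qed
qed

definition upper_pairs :: "nat \<Rightarrow> (nat \<times> nat) set" where
  "upper_pairs k = {(i, j). 1 \<le> i \<and> i < j \<and> j \<le> k}"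

lemma finite_upper_pairs [simp]: "finite (upper_pairs k)"
  by (rule finite_subset[of _ "{..k} \<times> {..k}"]) (auto simp: upper_pairs_def)

text \<open>The squared norm of the first \<open>k\<close> blocks of the left eigenvector.  The argument \<open>y\<close> carries the
upper-diagonal blocks in the encoding of the two families \<open>u\<close> (\<open>Inl\<close>) and \<open>v\<close> (\<open>Inr\<close>).\<close>

definition overlap_sum :: "(nat \<Rightarrow> complex) \<Rightarrow> nat \<Rightarrow> (nat \<times> nat + nat \<times> nat \<Rightarrow> complex) \<Rightarrow> real" where
  "overlap_sum l k y =
     (\<Sum>i=1..k. (norm (left_block l (\<lambda>i j. y (Inl (i, j))) (\<lambda>i j. y (Inr (i, j))) i))\<^sup>2)"

definition overlap_factor :: "(nat \<Rightarrow> complex) \<Rightarrow> nat \<Rightarrow> complex \<times> complex \<Rightarrow> real" where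
  "overlap_factor l k p =
     1 + (cmod (fst p))\<^sup>2 / (cmod (l 1 - l k))\<^sup>2 + (cmod (snd p))\<^sup>2 / (cmod (l 1 - cnj (l k)))\<^sup>2"

lemma overlap_factor_ge_1: "overlap_factor l k p \<ge> 1"
  by (simp add: overlap_factor_def)

lemma borel_measurable_overlap_factor:
  assumes "(\<lambda>x. l x 1) \<in> borel_measurable M" "(\<lambda>x. l x k) \<in> borel_measurable M"
    and "p \<in> borel_measurable M"
  shows "(\<lambda>x. overlap_factor (l x) k (p x)) \<in> borel_measurable M"
proof -
  show ?thesis unfolding overlap_factor_def
    by (intro borel_measurable_add borel_measurable_divide borel_measurable_power measurable_compose[OF _ borel_measurable_norm]
        borel_measurable_diff borel_measurable_const borel_measurable_cnj assms borel_measurable_fst_complex borel_measurable_snd_complex)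
qed

lemma borel_measurable_overlap_sum:
  assumes "\<And>i. 1 \<le> i \<Longrightarrow> i \<le> k \<Longrightarrow> (\<lambda>q. l q i) \<in> borel_measurable M"
    and "\<And>j. j \<in> upper_pairs k <+> upper_pairs k \<Longrightarrow> (\<lambda>q. y q j) \<in> borel_measurable M"
  shows "(\<lambda>q. overlap_sum (l q) k (y q)) \<in> borel_measurable M"
proof -
  have "(\<lambda>q. left_block (l q) (\<lambda>i j. y q (Inl (i, j))) (\<lambda>i j. y q (Inr (i, j))) i) \<in> borel_measurable M"
    if "i \<le> k" for i
    using that by (intro borel_measurable_left_block[where N = k] assms) (auto simp: upper_pairs_def)
  then show ?thesis
    unfolding overlap_sum_def
    by (intro borel_measurable_sum borel_measurable_power measurable_compose[OF _ borel_measurable_norm]) auto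
qed

text \<open>Integrate over the last block column for fixed earlier columns.  The earlier blocks of the left
eigenvector do not involve the last column, and \<open>gaussian_quat_sum\<close> gives the law of the sum that
determines the new block.  Where a difference of eigenvalues vanishes, both sides contain a division
by zero with value \<open>0\<close>.\<close>

lemma nn_integral_overlap_sum_Suc:
  fixes g :: "real \<Rightarrow> ennreal"
  assumes g: "g \<in> borel_measurable borel" and k: "k \<ge> 1"
  shows "(\<integral>\<^sup>+y. g (overlap_sum l (Suc k) y) \<partial>(\<Pi>\<^sub>M i\<in>upper_pairs (Suc k) <+> upper_pairs (Suc k). std_complex_gaussian)) =
    (\<integral>\<^sup>+y. \<integral>\<^sup>+p. g (overlap_sum l k y * overlap_factor l (Suc k) p) \<partial>iso_gaussian
      \<partial>(\<Pi>\<^sub>M i\<in>upper_pairs k <+> upper_pairs k. std_complex_gaussian))"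
proof -
  let ?J = "upper_pairs k <+> upper_pairs k" and ?C = "({1..k} \<times> {Suc k}) <+> ({1..k} \<times> {Suc k})"
  let ?\<alpha> = "l 1 - l (Suc k)" and ?\<beta> = "l 1 - cnj (l (Suc k))"
  have J: "upper_pairs (Suc k) <+> upper_pairs (Suc k) = ?J \<union> ?C"
    by (auto simp: upper_pairs_def Plus_def le_Suc_eq image_iff)
  have disj: "?J \<inter> ?C = {}" by (auto simp: upper_pairs_def)
  have fin: "finite ?J" "finite ?C" by auto
  have "(\<integral>\<^sup>+y. g (overlap_sum l (Suc k) y) \<partial>(\<Pi>\<^sub>M i\<in>upper_pairs (Suc k) <+> upper_pairs (Suc k). std_complex_gaussian)) =
     (\<integral>\<^sup>+y. \<integral>\<^sup>+c. g (overlap_sum l (Suc k) (merge ?J ?C (y, c))) \<partial>(\<Pi>\<^sub>M i\<in>?C. std_complex_gaussian)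
        \<partial>(\<Pi>\<^sub>M i\<in>?J. std_complex_gaussian))"
    using measurable_compose[OF borel_measurable_overlap_sum g, of "Suc k" "\<lambda>_. l"
        "\<Pi>\<^sub>M i\<in>?J \<union> ?C. std_complex_gaussian" "\<lambda>y. y"]
      borel_measurable_component_gaussian[of _ "?J \<union> ?C"]
    unfolding J by (intro gaussian_product.product_nn_integral_fold disj fin) simp
  also have "\<dots> = (\<integral>\<^sup>+y. \<integral>\<^sup>+p. g (overlap_sum l k y * overlap_factor l (Suc k) p) \<partial>iso_gaussian
      \<partial>(\<Pi>\<^sub>M i\<in>?J. std_complex_gaussian))"
  proof (rule nn_integral_cong)
    fix y :: "nat \<times> nat + nat \<times> nat \<Rightarrow> complex"
    define b where "b = left_block l (\<lambda>i j. y (Inl (i, j))) (\<lambda>i j. y (Inr (i, j)))"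
    define W where "W = (\<lambda>c :: nat \<times> nat + nat \<times> nat \<Rightarrow> complex.
      \<Sum>i=1..k. quat_mult (b i) (c (Inl (i, Suc k)), c (Inr (i, Suc k))))"
    define f where "f = (\<lambda>w :: complex \<times> complex. g (overlap_sum l k y + (cmod (fst w / ?\<alpha>))\<^sup>2 + (cmod (snd w / ?\<beta>))\<^sup>2))"
    have b1: "b 1 = (1, 0)" by (simp add: b_def left_block.simps)
    have S: "overlap_sum l k y = (\<Sum>i=1..k. (norm (b i))\<^sup>2)" by (simp add: overlap_sum_def b_def)
    have merge: "overlap_sum l (Suc k) (merge ?J ?C (y, c)) =
        overlap_sum l k y + (cmod (fst (W c) / ?\<alpha>))\<^sup>2 + (cmod (snd (W c) / ?\<beta>))\<^sup>2" for c
    proof -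
      let ?m = "merge ?J ?C (y, c)"
      have old: "left_block l (\<lambda>i j. ?m (Inl (i, j))) (\<lambda>i j. ?m (Inr (i, j))) i = b i" if "i \<le> k" for i
        unfolding b_def using that
        by (intro left_block_cong) (auto simp: merge_def upper_pairs_def)
      have new: "?m (Inl (i, Suc k)) = c (Inl (i, Suc k))" "?m (Inr (i, Suc k)) = c (Inr (i, Suc k))"
        if "i \<in> {1..k}" for i
        using that by (auto simp: merge_def upper_pairs_def)
      have "(\<Sum>i\<in>{1..<Suc k}. quat_mult (left_block l (\<lambda>i j. ?m (Inl (i, j))) (\<lambda>i j. ?m (Inr (i, j))) i)
          (?m (Inl (i, Suc k)), ?m (Inr (i, Suc k)))) = W c"
        unfolding W_def atLeastLessThanSuc_atLeastAtMost
      proof (intro sum.cong refl)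
        fix i assume i: "i \<in> {1..k}"
        then have "i \<le> k" by simp
        show "quat_mult (left_block l (\<lambda>i j. ?m (Inl (i, j))) (\<lambda>i j. ?m (Inr (i, j))) i)
          (?m (Inl (i, Suc k)), ?m (Inr (i, Suc k))) = quat_mult (b i) (c (Inl (i, Suc k)), c (Inr (i, Suc k)))"
          by (simp only: old[OF \<open>i \<le> k\<close>] new[OF i])
      qed
      then have "left_block l (\<lambda>i j. ?m (Inl (i, j))) (\<lambda>i j. ?m (Inr (i, j))) (Suc k) =
          (fst (W c) / ?\<alpha>, snd (W c) / ?\<beta>)"
        using k by (subst left_block.simps) (simp add: Let_def)
      then have "(norm (left_block l (\<lambda>i j. ?m (Inl (i, j))) (\<lambda>i j. ?m (Inr (i, j))) (Suc k)))\<^sup>2 =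
          (cmod (fst (W c) / ?\<alpha>))\<^sup>2 + (cmod (snd (W c) / ?\<beta>))\<^sup>2"
        by (simp add: norm_prod_def)
      moreover have "(\<Sum>i=1..k. (norm (left_block l (\<lambda>i j. ?m (Inl (i, j))) (\<lambda>i j. ?m (Inr (i, j))) i))\<^sup>2) =
          overlap_sum l k y"
        unfolding S by (intro sum.cong refl) (subst old, auto)
      ultimately show ?thesis
        unfolding overlap_sum_def[of l "Suc k"] sum.nat_ivl_Suc'[OF le_SucI[OF k]]
        by (simp only: ac_simps)
    qed
    have fm: "f \<in> borel_measurable borel" unfolding f_def
      by (intro measurable_compose[OF _ g] borel_measurable_add borel_measurable_power measurable_compose[OF _ borel_measurable_norm]
          borel_measurable_divide borel_measurable_const borel_measurable_fst_complex borel_measurable_snd_complex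
          measurable_ident_sets[OF refl])
    have "(\<integral>\<^sup>+c. g (overlap_sum l (Suc k) (merge ?J ?C (y, c))) \<partial>(\<Pi>\<^sub>M i\<in>?C. std_complex_gaussian)) =
        (\<integral>\<^sup>+c. f (W c) \<partial>(\<Pi>\<^sub>M i\<in>?C. std_complex_gaussian))"
      unfolding merge f_def ..
    also have "\<dots> = (\<integral>\<^sup>+p. f (sqrt (overlap_sum l k y) *\<^sub>R p) \<partial>iso_gaussian)"
      unfolding W_def S by (rule gaussian_quat_sum[where f = f and b = b and m = k, OF fm b1 k])
    also have "\<dots> = (\<integral>\<^sup>+p. g (overlap_sum l k y * overlap_factor l (Suc k) p) \<partial>iso_gaussian)"
    proof (intro nn_integral_cong)
      fix p :: "complex \<times> complex"
      have "overlap_sum l k y \<ge> 0" unfolding S by (intro sum_nonneg) simp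
      then show "f (sqrt (overlap_sum l k y) *\<^sub>R p) = g (overlap_sum l k y * overlap_factor l (Suc k) p)"
        unfolding f_def overlap_factor_def
        by (simp add: norm_divide power_divide power_mult_distrib algebra_simps)
    qed
    finally show "(\<integral>\<^sup>+c. g (overlap_sum l (Suc k) (merge ?J ?C (y, c))) \<partial>(\<Pi>\<^sub>M i\<in>?C. std_complex_gaussian)) =
        (\<integral>\<^sup>+p. g (overlap_sum l k y * overlap_factor l (Suc k) p) \<partial>iso_gaussian)" .
  qed
  finally show ?thesis .
qed

definition overlap_product :: "(nat \<Rightarrow> complex) \<Rightarrow> nat \<Rightarrow> (nat + nat \<Rightarrow> complex) \<Rightarrow> real" where
  "overlap_product l k x = (\<Prod>j=2..k. overlap_factor l j (x (Inl j), x (Inr j)))"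

lemma overlap_product_nonneg: "overlap_product l k x \<ge> 0"
  unfolding overlap_product_def by (intro prod_nonneg) (meson overlap_factor_ge_1 order_trans zero_le_one)

lemma borel_measurable_overlap_product:
  assumes "\<And>i. 1 \<le> i \<Longrightarrow> i \<le> k \<Longrightarrow> (\<lambda>q. l q i) \<in> borel_measurable M"
    and "\<And>j. j \<in> {2..k} <+> {2..k} \<Longrightarrow> (\<lambda>q. x q j) \<in> borel_measurable M"
  shows "(\<lambda>q. overlap_product (l q) k (x q)) \<in> borel_measurable M"
  unfolding overlap_product_def
  by (intro borel_measurable_prod borel_measurable_overlap_factor borel_measurable_Pair assms) auto

lemma nn_integral_overlap_product_Suc:
  fixes g :: "real \<Rightarrow> ennreal"
  assumes g: "g \<in> borel_measurable borel" and k: "k \<ge> 1"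
  shows "(\<integral>\<^sup>+x. g (overlap_product l (Suc k) x) \<partial>(\<Pi>\<^sub>M i\<in>{2..Suc k} <+> {2..Suc k}. std_complex_gaussian)) =
    (\<integral>\<^sup>+x. \<integral>\<^sup>+p. g (overlap_product l k x * overlap_factor l (Suc k) p) \<partial>iso_gaussian
      \<partial>(\<Pi>\<^sub>M i\<in>{2..k} <+> {2..k}. std_complex_gaussian))"
proof -
  let ?K = "{2..k} <+> {2..k}"
  have K: "{2..Suc k} <+> {2..Suc k} = insert (Inl (Suc k)) (insert (Inr (Suc k)) ?K)"
    using k by (auto simp: Plus_def le_Suc_eq image_iff)
  have upd: "overlap_product l (Suc k) (x(Inr (Suc k) := snd p, Inl (Suc k) := fst p)) =
      overlap_product l k x * overlap_factor l (Suc k) p" for x p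
  proof -
    have "(\<Prod>j=2..k. overlap_factor l j ((x(Inr (Suc k) := snd p, Inl (Suc k) := fst p)) (Inl j),
        (x(Inr (Suc k) := snd p, Inl (Suc k) := fst p)) (Inr j))) = overlap_product l k x"
      unfolding overlap_product_def by (intro prod.cong refl) auto
    then show ?thesis using k unfolding overlap_product_def by (simp add: mult.commute)
  qed
  have "(\<integral>\<^sup>+x. g (overlap_product l (Suc k) x) \<partial>(\<Pi>\<^sub>M i\<in>{2..Suc k} <+> {2..Suc k}. std_complex_gaussian)) =
     (\<integral>\<^sup>+x. \<integral>\<^sup>+p. g (overlap_product l (Suc k) (x(Inr (Suc k) := snd p, Inl (Suc k) := fst p))) \<partial>iso_gaussian
      \<partial>(\<Pi>\<^sub>M i\<in>?K. std_complex_gaussian))"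
    using measurable_compose[OF borel_measurable_overlap_product g, of "Suc k" "\<lambda>_. l"
        "\<Pi>\<^sub>M i\<in>{2..Suc k} <+> {2..Suc k}. std_complex_gaussian" "\<lambda>y. y"]
      borel_measurable_component_gaussian[of _ "{2..Suc k} <+> {2..Suc k}"]
    unfolding K by (intro nn_integral_PiM_insert_pair) auto
  then show ?thesis unfolding upd .
qed

lemma borel_measurable_nn_integral_overlap_factor:
  assumes g: "g \<in> borel_measurable borel"
  shows "(\<lambda>s. \<integral>\<^sup>+p. g (s * overlap_factor l k p) \<partial>iso_gaussian) \<in> borel_measurable borel"
proof -
  interpret S: sigma_finite_measure "iso_gaussian :: (complex \<times> complex) measure" by (rule sigma_finite_iso_gaussian)
  have "(\<lambda>q. g (fst q * overlap_factor l k (snd q))) \<in> borel_measurable (borel \<Otimes>\<^sub>M iso_gaussian)"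
    by (intro measurable_compose[OF _ g] borel_measurable_times measurable_fst borel_measurable_overlap_factor
        borel_measurable_const) (simp add: measurable_snd cong: measurable_cong_sets)+
  then show ?thesis
    by (intro S.borel_measurable_nn_integral) (simp add: split_beta')
qed

text \<open>Both laws satisfy the same recursion in \<open>k\<close>.  Testing against all non-negative \<open>g\<close> expresses
equality in law, and the inner integral over \<open>p\<close> is a new test function for the induction.\<close>

lemma overlap_sum_distributed_as_product:
  fixes g :: "real \<Rightarrow> ennreal"
  assumes "k \<ge> 1" and "g \<in> borel_measurable borel"
  shows "(\<integral>\<^sup>+y. g (overlap_sum l k y) \<partial>(\<Pi>\<^sub>M i\<in>upper_pairs k <+> upper_pairs k. std_complex_gaussian)) =
    (\<integral>\<^sup>+x. g (overlap_product l k x) \<partial>(\<Pi>\<^sub>M i\<in>{2..k} <+> {2..k}. std_complex_gaussian))"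
  using assms
proof (induction k arbitrary: g rule: nat_induct_at_least)
  case base
  have "upper_pairs 1 = {}" by (auto simp: upper_pairs_def)
  moreover have "overlap_sum l 1 y = 1" for y by (simp add: overlap_sum_def left_block.simps norm_prod_def)
  moreover have "overlap_product l 1 x = 1" for x by (simp add: overlap_product_def)
  ultimately show ?case by (simp add: Plus_def PiM_empty nn_integral_count_space_finite)
next
  case (Suc k)
  show ?case
    unfolding nn_integral_overlap_sum_Suc[OF Suc.prems Suc.hyps]
      nn_integral_overlap_product_Suc[OF Suc.prems Suc.hyps]
    by (rule Suc.IH) (rule borel_measurable_nn_integral_overlap_factor[OF Suc.prems])
qed

lemma nn_integral_overlap_factor:
  assumes r: "r \<ge> 0"
  shows "(\<integral>\<^sup>+p. ennreal (r * overlap_factor l k p) \<partial>iso_gaussian) =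
    ennreal (r * (1 + 1 / (cmod (l 1 - l k))\<^sup>2 + 1 / (cmod (l 1 - cnj (l k)))\<^sup>2))"
proof -
  interpret G: prob_space "iso_gaussian :: complex measure" by (rule prob_space_iso_gaussian)
  interpret P: prob_space "iso_gaussian :: (complex \<times> complex) measure" by (rule prob_space_iso_gaussian)
  interpret S: pair_sigma_finite "iso_gaussian :: complex measure" "iso_gaussian :: complex measure" ..
  let ?a = "r / (cmod (l 1 - l k))\<^sup>2" and ?b = "r / (cmod (l 1 - cnj (l k)))\<^sup>2"
  have 1: "(\<integral>\<^sup>+p. ennreal ((cmod (fst p))\<^sup>2) \<partial>(iso_gaussian :: (complex \<times> complex) measure)) = 1"
    unfolding iso_gaussian_prod[symmetric]
    by (subst G.nn_integral_fst[symmetric]) (simp_all add: nn_integral_cmod_square_gaussian G.emeasure_space_1[simplified])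
  have 2: "(\<integral>\<^sup>+p. ennreal ((cmod (snd p))\<^sup>2) \<partial>(iso_gaussian :: (complex \<times> complex) measure)) = 1"
    unfolding iso_gaussian_prod[symmetric]
    by (subst G.nn_integral_fst[symmetric]) (simp_all add: nn_integral_cmod_square_gaussian G.emeasure_space_1[simplified])
  have m: "(\<lambda>p. ennreal ((cmod (fst p))\<^sup>2)) \<in> borel_measurable (iso_gaussian :: (complex \<times> complex) measure)"
    "(\<lambda>p. ennreal ((cmod (snd p))\<^sup>2)) \<in> borel_measurable (iso_gaussian :: (complex \<times> complex) measure)"
    unfolding iso_gaussian_prod[symmetric] by measurable
  have "(\<integral>\<^sup>+p. ennreal (r * overlap_factor l k p) \<partial>iso_gaussian) =
      (\<integral>\<^sup>+p. (ennreal r + ennreal ?a * ennreal ((cmod (fst p))\<^sup>2)) + ennreal ?b * ennreal ((cmod (snd p))\<^sup>2) \<partial>iso_gaussian)"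
    using r by (intro nn_integral_cong)
      (simp add: overlap_factor_def ennreal_mult'[symmetric] algebra_simps flip: ennreal_plus)
  also have "\<dots> = (ennreal r + ennreal ?a * 1) + ennreal ?b * 1"
    using m by (simp add: 1 2 nn_integral_add nn_integral_cmult P.emeasure_space_1[simplified])
  also have "\<dots> = ennreal (r * (1 + 1 / (cmod (l 1 - l k))\<^sup>2 + 1 / (cmod (l 1 - cnj (l k)))\<^sup>2))"
    using r by (simp add: algebra_simps flip: ennreal_plus)
  finally show ?thesis .
qed

lemma nn_integral_overlap_product:
  assumes "k \<ge> 1"
  shows "(\<integral>\<^sup>+x. ennreal (overlap_product l k x) \<partial>(\<Pi>\<^sub>M i\<in>{2..k} <+> {2..k}. std_complex_gaussian)) =
    ennreal (\<Prod>j=2..k. 1 + 1 / (cmod (l 1 - l j))\<^sup>2 + 1 / (cmod (l 1 - cnj (l j)))\<^sup>2)"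
  using assms
proof (induction k rule: nat_induct_at_least)
  case base
  show ?case by (simp add: overlap_product_def Plus_def PiM_empty nn_integral_count_space_finite)
next
  case (Suc k)
  let ?t = "\<lambda>j. 1 + 1 / (cmod (l 1 - l j))\<^sup>2 + 1 / (cmod (l 1 - cnj (l j)))\<^sup>2"
  have m: "(\<lambda>x. ennreal (overlap_product l k x)) \<in> borel_measurable (\<Pi>\<^sub>M i\<in>{2..k} <+> {2..k}. std_complex_gaussian)"
    by (intro measurable_compose[OF borel_measurable_overlap_product measurable_ennreal]
        borel_measurable_const borel_measurable_component_gaussian)
  have "(\<integral>\<^sup>+x. ennreal (overlap_product l (Suc k) x) \<partial>(\<Pi>\<^sub>M i\<in>{2..Suc k} <+> {2..Suc k}. std_complex_gaussian)) =
      (\<integral>\<^sup>+x. ennreal (overlap_product l k x) * ennreal (?t (Suc k)) \<partial>(\<Pi>\<^sub>M i\<in>{2..k} <+> {2..k}. std_complex_gaussian))"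
    unfolding nn_integral_overlap_product_Suc[OF measurable_ennreal Suc.hyps]
      nn_integral_overlap_factor[OF overlap_product_nonneg]
    by (simp add: ennreal_mult overlap_product_nonneg)
  also have "\<dots> = ennreal (\<Prod>j=2..k. ?t j) * ennreal (?t (Suc k))"
    unfolding Suc.IH[symmetric] by (rule nn_integral_multc[OF m])
  also have "\<dots> = ennreal (\<Prod>j=2..Suc k. ?t j)"
  proof -
    have "(\<Prod>j=2..Suc k. ?t j) = (\<Prod>j=2..k. ?t j) * ?t (Suc k)" using Suc.hyps by simp
    then show ?thesis by (simp only:) (rule ennreal_mult''[symmetric], simp)
  qed
  finally show ?case .
qed

section \<open>Conditioning on the eigenvalues\<close>

text \<open>The independence makes the joint law of the two families a product measure, so the integral of \<open>f\<close>
over an event described by \<open>X\<close> can be evaluated by integrating over \<open>Y\<close> first.  As \<open>f \<ge> 0\<close>, the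
negative part in the definition of \<^const>\<open>real_cond_exp\<close> vanishes, and Tonelli's theorem applies.\<close>

lemma real_cond_exp_indep_families:
  fixes X :: "'i \<Rightarrow> 'w \<Rightarrow> complex" and Y :: "'j \<Rightarrow> 'w \<Rightarrow> complex"
    and I :: "'i set" and J :: "'j set"
  defines "XX \<equiv> \<lambda>\<omega>. \<lambda>i\<in>I. X i \<omega>" and "YY \<equiv> \<lambda>\<omega>. \<lambda>j\<in>J. Y j \<omega>"
  assumes M: "prob_space M"
    and X: "\<And>i. i \<in> I \<Longrightarrow> X i \<in> borel_measurable M"
    and Y: "\<And>j. j \<in> J \<Longrightarrow> Y j \<in> borel_measurable M"
    and ind: "indep_families M I X J Y"
    and f[measurable]: "f \<in> borel_measurable ((\<Pi>\<^sub>M i\<in>I. borel) \<Otimes>\<^sub>M (\<Pi>\<^sub>M j\<in>J. borel))"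
    and f0: "\<And>x. f x \<ge> (0::real)"
    and \<phi>: "\<And>\<omega>. \<omega> \<in> space M \<Longrightarrow> \<phi> \<omega> = f (XX \<omega>, YY \<omega>)"
  shows "AE \<omega> in M. real_cond_exp M (generated_algebra M I X) \<phi> \<omega> =
    enn2real (\<integral>\<^sup>+y. ennreal (f (XX \<omega>, y)) \<partial>distr M (\<Pi>\<^sub>M j\<in>J. borel) YY)"
proof -
  interpret prob_space M by fact
  define F where "F = generated_algebra M I X"
  let ?P = "\<Pi>\<^sub>M i\<in>I. (borel :: complex measure)" and ?Q = "\<Pi>\<^sub>M j\<in>J. (borel :: complex measure)"
  have [measurable]: "XX \<in> M \<rightarrow>\<^sub>M ?P" unfolding XX_def by (intro measurable_restrict X)
  have [measurable]: "YY \<in> M \<rightarrow>\<^sub>M ?Q" unfolding YY_def by (intro measurable_restrict Y)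
  have F: "F = vimage_algebra (space M) XX ?P" unfolding F_def generated_algebra_def XX_def ..
  have XXs: "XX \<in> space M \<rightarrow> space ?P" by (rule measurable_space[THEN funcsetI]) measurable
  have setsF: "sets F = {XX -` A \<inter> space M | A. A \<in> sets ?P}"
    unfolding F by (rule sets_vimage_algebra2[OF XXs])
  have spaceF: "space F = space M" unfolding F by simp
  have sub: "subalgebra M F"
    unfolding subalgebra_def spaceF setsF by (auto intro: measurable_sets)
  interpret finite_measure_subalgebra M F by unfold_locales (rule sub)
  have XXF[measurable]: "XX \<in> F \<rightarrow>\<^sub>M ?P" unfolding F by (rule measurable_vimage_algebra1[OF XXs])
  interpret Q: prob_space "distr M ?Q YY" by (rule prob_space_distr) measurable
  interpret P: prob_space "distr M ?P XX" by (rule prob_space_distr) measurable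
  have gen: "F = generated_algebra M I X" "sets (generated_algebra M J Y) = {YY -` B \<inter> space M | B. B \<in> sets ?Q}"
    unfolding F_def generated_algebra_def YY_def
    by (simp_all add: sets_vimage_algebra2 Pi_iff space_PiM)
  have joint: "distr M ?P XX \<Otimes>\<^sub>M distr M ?Q YY = distr M (?P \<Otimes>\<^sub>M ?Q) (\<lambda>\<omega>. (XX \<omega>, YY \<omega>))"
  proof (rule pair_measure_eqI)
    fix A B assume "A \<in> sets (distr M ?P XX)" "B \<in> sets (distr M ?Q YY)"
    then have [measurable]: "A \<in> sets ?P" "B \<in> sets ?Q" by auto
    have "XX -` A \<inter> space M \<in> sets F" "YY -` B \<inter> space M \<in> sets (generated_algebra M J Y)"
      unfolding setsF gen(2) by auto
    then have "prob ((XX -` A \<inter> space M) \<inter> (YY -` B \<inter> space M)) =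
        prob (XX -` A \<inter> space M) * prob (YY -` B \<inter> space M)"
      using ind unfolding indep_families_def gen(1)[symmetric] by (intro indep_setD)
    moreover have "(\<lambda>\<omega>. (XX \<omega>, YY \<omega>)) -` (A \<times> B) \<inter> space M = (XX -` A \<inter> space M) \<inter> (YY -` B \<inter> space M)"
      by auto
    ultimately show "emeasure (distr M ?P XX) A * emeasure (distr M ?Q YY) B =
        emeasure (distr M (?P \<Otimes>\<^sub>M ?Q) (\<lambda>\<omega>. (XX \<omega>, YY \<omega>))) (A \<times> B)"
      by (simp add: emeasure_distr emeasure_eq_measure ennreal_mult'[symmetric])
  next
    show "sets (distr M ?P XX \<Otimes>\<^sub>M distr M ?Q YY) = sets (distr M (?P \<Otimes>\<^sub>M ?Q) (\<lambda>\<omega>. (XX \<omega>, YY \<omega>)))"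
      unfolding sets_distr by (rule sets_pair_measure_cong) (rule sets_distr)+
  qed (rule P.sigma_finite_measure_axioms Q.sigma_finite_measure_axioms)+
  have f'[measurable]: "(\<lambda>(x, y). ennreal (f (x, y))) \<in> borel_measurable (?P \<Otimes>\<^sub>M distr M ?Q YY)"
    by measurable
  define g where "g = (\<lambda>x. \<integral>\<^sup>+y. ennreal (f (x, y)) \<partial>distr M ?Q YY)"
  have [measurable]: "g \<in> borel_measurable ?P" unfolding g_def
    by (rule Q.borel_measurable_nn_integral) (rule f')
  have \<phi>m[measurable]: "\<phi> \<in> borel_measurable M"
    by (subst measurable_cong[OF \<phi>]) measurable
  have "AE \<omega> in M. g (XX \<omega>) = nn_cond_exp M F (\<lambda>\<omega>. ennreal (\<phi> \<omega>)) \<omega>"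
  proof (rule nn_cond_exp_charact)
    fix A assume "A \<in> sets F"
    then obtain A' where A'[measurable]: "A' \<in> sets ?P" and A: "A = XX -` A' \<inter> space M" unfolding setsF by blast
    have "(\<integral>\<^sup>+\<omega>\<in>A. ennreal (\<phi> \<omega>) \<partial>M) =
        (\<integral>\<^sup>+\<omega>. (\<lambda>(x, y). ennreal (f (x, y)) * indicator A' x) (XX \<omega>, YY \<omega>) \<partial>M)"
      by (intro nn_integral_cong) (auto simp: A \<phi> indicator_def)
    also have "\<dots> = (\<integral>\<^sup>+z. (\<lambda>(x, y). ennreal (f (x, y)) * indicator A' x) z
        \<partial>distr M (?P \<Otimes>\<^sub>M ?Q) (\<lambda>\<omega>. (XX \<omega>, YY \<omega>)))"
      by (rule nn_integral_distr[symmetric]) measurable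
    also have "\<dots> = (\<integral>\<^sup>+x. \<integral>\<^sup>+y. ennreal (f (x, y)) * indicator A' x \<partial>distr M ?Q YY \<partial>distr M ?P XX)"
      unfolding joint[symmetric] by (subst Q.nn_integral_fst[symmetric]) simp_all
    also have "\<dots> = (\<integral>\<^sup>+x. g x * indicator A' x \<partial>distr M ?P XX)"
    proof (rule nn_integral_cong)
      fix x assume "x \<in> space (distr M ?P XX)"
      then have [measurable]: "x \<in> space ?P" by simp
      show "(\<integral>\<^sup>+y. ennreal (f (x, y)) * indicator A' x \<partial>distr M ?Q YY) = g x * indicator A' x"
        unfolding g_def by (rule nn_integral_multc) measurable
    qed
    also have "\<dots> = (\<integral>\<^sup>+\<omega>. g (XX \<omega>) * indicator A' (XX \<omega>) \<partial>M)"
      by (rule nn_integral_distr) measurable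
    also have "\<dots> = (\<integral>\<^sup>+\<omega>\<in>A. g (XX \<omega>) \<partial>M)"
      by (intro nn_integral_cong) (auto simp: A indicator_def)
    finally show "(\<integral>\<^sup>+\<omega>\<in>A. ennreal (\<phi> \<omega>) \<partial>M) = (\<integral>\<^sup>+\<omega>\<in>A. g (XX \<omega>) \<partial>M)" .
  qed measurable
  moreover have "AE \<omega> in M. nn_cond_exp M F (\<lambda>\<omega>. ennreal (- \<phi> \<omega>)) \<omega> = nn_cond_exp M F (\<lambda>_. 0) \<omega>"
    by (rule nn_cond_exp_cong) (auto simp: \<phi> f0 ennreal_neg)
  moreover have "AE \<omega> in M. 0 = nn_cond_exp M F (\<lambda>_. 0) \<omega>"
    by (rule nn_cond_exp_F_meas) simp
  ultimately show ?thesis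
    unfolding F_def[symmetric]
    by eventually_elim (simp add: real_cond_exp_def g_def)
qed

lemma borel_measurable_eigenvalue_weight:
  assumes "\<And>i. 1 \<le> i \<Longrightarrow> i \<le> N \<Longrightarrow> (\<lambda>q. l q i) \<in> borel_measurable M"
  shows "(\<lambda>q. eigenvalue_weight N (l q)) \<in> borel_measurable M"
proof -
  show ?thesis unfolding eigenvalue_weight_def split_beta
    by (intro borel_measurable_times borel_measurable_prod borel_measurable_power borel_measurable_diff
        measurable_compose[OF _ borel_measurable_norm] assms borel_measurable_cnj) auto
qed

lemma borel_measurable_fst_component:
  "i \<in> I \<Longrightarrow> (\<lambda>q. fst q i) \<in> borel_measurable ((\<Pi>\<^sub>M i\<in>I. borel) \<Otimes>\<^sub>M P)"
  by (rule measurable_compose[OF measurable_fst measurable_component_singleton])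

lemma borel_measurable_snd_component:
  "i \<in> I \<Longrightarrow> (\<lambda>q. snd q i) \<in> borel_measurable (P \<Otimes>\<^sub>M (\<Pi>\<^sub>M i\<in>I. borel))"
  by (rule measurable_compose[OF measurable_snd measurable_component_singleton])

theorem theorem3p4:
  fixes M :: "'w measure" and N :: nat
    and z w u v :: "nat \<Rightarrow> nat \<Rightarrow> 'w \<Rightarrow> complex"
    and G :: "'w \<Rightarrow> complex mat"
    and lam X Y :: "nat \<Rightarrow> 'w \<Rightarrow> complex"
    and O11 :: "'w \<Rightarrow> real"
  defines "upper \<equiv> {(i, j). 1 \<le> i \<and> i < j \<and> j \<le> N}"
    and "s \<equiv> sqrt (2 * real N)"
    and "F \<equiv> generated_algebra M {1..N} lam"
  assumes "prob_space M" and "N \<ge> 1"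
    (* the unscaled quaternionic Ginibre matrix *)
    and "iid_std_complex_gaussian M (({1..N} \<times> {1..N}) <+> ({1..N} \<times> {1..N}))
           (case_sum (case_prod z) (case_prod w))"
    and "\<And>\<omega>. \<omega> \<in> space M \<Longrightarrow>
           G \<omega> = quaternionic_mat N (\<lambda>i j. z i j \<omega>) (\<lambda>i j. w i j \<omega>)"
    (* joint law of the labelled eigenvalues; lam are the scaled ones, s * lam the unscaled ones *)
    and "\<And>i. i \<in> {1..N} \<Longrightarrow> lam i \<in> borel_measurable M"
    and "\<exists>c>0. distr M (\<Pi>\<^sub>M i\<in>{1..N}. borel) (\<lambda>\<omega>. \<lambda>i\<in>{1..N}. of_real s * lam i \<omega>) =
           density (\<Pi>\<^sub>M i\<in>{1..N}. std_complex_gaussian) (\<lambda>l. ennreal (c * eigenvalue_weight N l))"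
    (* Schur form *)
    and "iid_std_complex_gaussian M (upper <+> upper) (case_sum (case_prod u) (case_prod v))"
    and "indep_families M {1..N} lam (upper <+> upper) (case_sum (case_prod u) (case_prod v))"
    and "\<And>\<omega>. \<omega> \<in> space M \<Longrightarrow> unitarily_equivalent (G \<omega>)
           (schur_mat N (\<lambda>i. of_real s * lam i \<omega>) (\<lambda>i j. u i j \<omega>) (\<lambda>i j. v i j \<omega>))"
    (* the Gaussian variables of the product *)
    and "iid_std_complex_gaussian M ({2..N} <+> {2..N}) (case_sum X Y)"
    and "indep_families M {1..N} lam ({2..N} <+> {2..N}) (case_sum X Y)"
  defines "O11 \<equiv> \<lambda>\<omega>. diagonal_overlap (of_real (1 / s) \<cdot>\<^sub>m G \<omega>) (lam 1 \<omega>)"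
  shows "cond_eq_in_distribution M F
           {\<omega> \<in> space M. Psi ((\<lambda>i. lam i \<omega>) ` {1..N}) \<subseteq> ball 0 1}
           O11
           (\<lambda>\<omega>. \<Prod>k=2..N. 1 + (cmod (X k \<omega>))\<^sup>2 / (2 * real N * (cmod (lam 1 \<omega> - lam k \<omega>))\<^sup>2)
                             + (cmod (Y k \<omega>))\<^sup>2 / (2 * real N * (cmod (lam 1 \<omega> - cnj (lam k \<omega>)))\<^sup>2))
       \<and> (AE \<omega> in M. real_cond_exp M F O11 \<omega> =
           (\<Prod>k=2..N. 1 + 1 / (2 * real N * (cmod (lam 1 \<omega> - lam k \<omega>))\<^sup>2)
                          + 1 / (2 * real N * (cmod (lam 1 \<omega> - cnj (lam k \<omega>)))\<^sup>2)))"
proof -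
  note upper_def = assms(1) and s_def = assms(2) and F_def = assms(3)
  note M = assms(4) and N = assms(5) and lam = assms(8) and law = assms(9)
    and uv = assms(10) and lam_uv = assms(11) and schur = assms(12)
    and XY = assms(13) and lam_XY = assms(14) and O11_def = assms(15)
  have up: "upper = upper_pairs N" unfolding upper_def upper_pairs_def ..
  have s: "s > 0" "s \<noteq> 0" "s\<^sup>2 = 2 * real N" using N by (simp_all add: s_def)
  let ?J = "upper_pairs N <+> upper_pairs N" and ?K = "{2..N} <+> {2..N}"
  let ?UV = "case_sum (case_prod u) (case_prod v)" and ?XY = "case_sum X Y"
  define L where "L = (\<lambda>\<omega>. \<lambda>i\<in>{1..N}. lam i \<omega>)"
  define U where "U = (\<lambda>\<omega>. \<lambda>j\<in>?J. ?UV j \<omega>)"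
  define V where "V = (\<lambda>\<omega>. \<lambda>j\<in>?K. ?XY j \<omega>)"
  define sc where "sc = (\<lambda>(l :: nat \<Rightarrow> complex) i. of_real s * l i)"
  define g where "g = (\<lambda>(l, y). if eigenvalue_weight N l = 0 then 0 else overlap_sum (sc l) N y)"
  define h where "h = (\<lambda>(l, x). overlap_product (sc l) N x)"
  define prd where "prd = (\<lambda>\<omega>. \<Prod>k=2..N. 1 + (cmod (X k \<omega>))\<^sup>2 / (2 * real N * (cmod (lam 1 \<omega> - lam k \<omega>))\<^sup>2)
       + (cmod (Y k \<omega>))\<^sup>2 / (2 * real N * (cmod (lam 1 \<omega> - cnj (lam k \<omega>)))\<^sup>2))"
  \<comment> \<open>the recursion works with the unscaled eigenvalues, whose gaps carry the factor \<open>2 N\<close>\<close>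
  have gap: "(cmod (sc (L \<omega>) 1 - sc (L \<omega>) k))\<^sup>2 = 2 * real N * (cmod (lam 1 \<omega> - lam k \<omega>))\<^sup>2"
    "(cmod (sc (L \<omega>) 1 - cnj (sc (L \<omega>) k)))\<^sup>2 = 2 * real N * (cmod (lam 1 \<omega> - cnj (lam k \<omega>)))\<^sup>2"
    if "k \<in> {2..N}" for k \<omega>
    using that N s by (simp_all add: sc_def L_def norm_mult power_mult_distrib flip: right_diff_distrib)
  have weight: "eigenvalue_weight N (L \<omega>) = eigenvalue_weight N (\<lambda>i. lam i \<omega>)" for \<omega>
    unfolding L_def by (rule eigenvalue_weight_restrict)
  have O11: "O11 \<omega> = g (L \<omega>, U \<omega>)" if "\<omega> \<in> space M" for \<omega>
  proof -
    have "left_block (\<lambda>i. of_real s * lam i \<omega>) (\<lambda>i j. u i j \<omega>) (\<lambda>i j. v i j \<omega>) k =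
        left_block (sc (L \<omega>)) (\<lambda>i j. U \<omega> (Inl (i, j))) (\<lambda>i j. U \<omega> (Inr (i, j))) k" if "k \<in> {1..N}" for k
      using that by (intro left_block_cong) (auto simp: sc_def L_def U_def upper_pairs_def)
    then show ?thesis
      unfolding O11_def diagonal_overlap_scaled[OF N s(2) schur[OF that]]
      by (simp add: g_def weight overlap_sum_def)
  qed
  have prd: "prd \<omega> = h (L \<omega>, V \<omega>)" for \<omega>
    unfolding prd_def h_def prod.case overlap_product_def
  proof (intro prod.cong refl)
    fix k assume k: "k \<in> {2..N}"
    then have "V \<omega> (Inl k) = X k \<omega>" "V \<omega> (Inr k) = Y k \<omega>" by (auto simp: V_def)
    then show "1 + (cmod (X k \<omega>))\<^sup>2 / (2 * real N * (cmod (lam 1 \<omega> - lam k \<omega>))\<^sup>2)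
       + (cmod (Y k \<omega>))\<^sup>2 / (2 * real N * (cmod (lam 1 \<omega> - cnj (lam k \<omega>)))\<^sup>2) =
       overlap_factor (sc (L \<omega>)) k (V \<omega> (Inl k), V \<omega> (Inr k))"
      by (simp only: overlap_factor_def gap[OF k] fst_conv snd_conv)
  qed
  have g0: "g q \<ge> 0" for q
    by (auto simp: g_def overlap_sum_def sum_nonneg split: prod.split)
  have gm: "g \<in> borel_measurable ((\<Pi>\<^sub>M i\<in>{1..N}. borel) \<Otimes>\<^sub>M (\<Pi>\<^sub>M j\<in>?J. borel))"
  proof -
    have [measurable]: "(\<lambda>q. eigenvalue_weight N (fst q)) \<in> borel_measurable ((\<Pi>\<^sub>M i\<in>{1..N}. borel) \<Otimes>\<^sub>M (\<Pi>\<^sub>M j\<in>?J. borel))"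
      by (intro borel_measurable_eigenvalue_weight borel_measurable_fst_component) auto
    have [measurable]: "(\<lambda>q. overlap_sum (sc (fst q)) N (snd q)) \<in> borel_measurable ((\<Pi>\<^sub>M i\<in>{1..N}. borel) \<Otimes>\<^sub>M (\<Pi>\<^sub>M j\<in>?J. borel))"
      unfolding sc_def
      by (intro borel_measurable_overlap_sum borel_measurable_times borel_measurable_const
          borel_measurable_fst_component borel_measurable_snd_component) auto
    show ?thesis unfolding g_def split_beta' by measurable
  qed
  have hm: "h \<in> borel_measurable ((\<Pi>\<^sub>M i\<in>{1..N}. borel) \<Otimes>\<^sub>M (\<Pi>\<^sub>M j\<in>?K. borel))"
    unfolding h_def split_beta' sc_def
    by (intro borel_measurable_overlap_product borel_measurable_times borel_measurable_const
        borel_measurable_fst_component borel_measurable_snd_component) auto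
  have condO: "AE \<omega> in M. real_cond_exp M F \<phi> \<omega> =
      enn2real (\<integral>\<^sup>+y. ennreal (F0 (g (L \<omega>, y))) \<partial>(\<Pi>\<^sub>M j\<in>?J. std_complex_gaussian))"
    if F0: "F0 \<in> borel_measurable borel" "\<And>r. F0 r \<ge> 0" "\<And>\<omega>. \<omega> \<in> space M \<Longrightarrow> \<phi> \<omega> = F0 (g (L \<omega>, U \<omega>))"
    for F0 \<phi> :: "_ \<Rightarrow> real"
    unfolding F_def iid_std_complex_gaussian_distr[OF M uv[unfolded up], symmetric] L_def
    by (rule real_cond_exp_indep_families[where f = "\<lambda>q. F0 (g q)", OF M lam
          iid_std_complex_gaussian_measurable[OF M uv[unfolded up]] lam_uv[unfolded up]
          measurable_compose[OF gm F0(1)]])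
       (use F0 in \<open>simp_all add: L_def U_def\<close>)
  have condP: "AE \<omega> in M. real_cond_exp M F \<phi> \<omega> =
      enn2real (\<integral>\<^sup>+y. ennreal (F0 (h (L \<omega>, y))) \<partial>(\<Pi>\<^sub>M j\<in>?K. std_complex_gaussian))"
    if F0: "F0 \<in> borel_measurable borel" "\<And>r. F0 r \<ge> 0" "\<And>\<omega>. \<omega> \<in> space M \<Longrightarrow> \<phi> \<omega> = F0 (h (L \<omega>, V \<omega>))"
    for F0 \<phi> :: "_ \<Rightarrow> real"
    unfolding F_def iid_std_complex_gaussian_distr[OF M XY, symmetric] L_def
    by (rule real_cond_exp_indep_families[where f = "\<lambda>q. F0 (h q)", OF M lam
          iid_std_complex_gaussian_measurable[OF M XY] lam_XY measurable_compose[OF hm F0(1)]])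
       (use F0 in \<open>simp_all add: L_def V_def\<close>)
  have same: "(\<integral>\<^sup>+y. ennreal (F0 (g (L \<omega>, y))) \<partial>(\<Pi>\<^sub>M j\<in>?J. std_complex_gaussian)) =
      (\<integral>\<^sup>+y. ennreal (F0 (h (L \<omega>, y))) \<partial>(\<Pi>\<^sub>M j\<in>?K. std_complex_gaussian))"
    if "F0 \<in> borel_measurable borel" "eigenvalue_weight N (L \<omega>) \<noteq> 0" for F0 :: "real \<Rightarrow> real" and \<omega>
    using overlap_sum_distributed_as_product[OF N measurable_compose[OF that(1) measurable_ennreal], of "sc (L \<omega>)"] that(2)
    by (simp add: g_def h_def)
  \<comment> \<open>the eigenvalue law is given by a density, and gives no mass to the zeros of that density\<close>
  have distinct: "AE \<omega> in M. eigenvalue_weight N (L \<omega>) \<noteq> 0"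
  proof -
    from law obtain c :: real where "c > 0" and law: "distr M (\<Pi>\<^sub>M i\<in>{1..N}. borel) (\<lambda>\<omega>. \<lambda>i\<in>{1..N}. of_real s * lam i \<omega>) =
           density (\<Pi>\<^sub>M i\<in>{1..N}. std_complex_gaussian) (\<lambda>l. ennreal (c * eigenvalue_weight N l))"
      by blast
    have [measurable]: "eigenvalue_weight N \<in> borel_measurable (\<Pi>\<^sub>M i\<in>{1..N}. std_complex_gaussian)"
      "eigenvalue_weight N \<in> borel_measurable (\<Pi>\<^sub>M i\<in>{1..N}. borel)"
      by (intro borel_measurable_eigenvalue_weight borel_measurable_component_gaussian; simp)
         (intro borel_measurable_eigenvalue_weight measurable_component_singleton; simp)
    have "AE l in density (\<Pi>\<^sub>M i\<in>{1..N}. std_complex_gaussian) (\<lambda>l. ennreal (c * eigenvalue_weight N l)).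
        eigenvalue_weight N l \<noteq> 0"
    proof (subst AE_density)
      show "(\<lambda>l. ennreal (c * eigenvalue_weight N l)) \<in> borel_measurable (\<Pi>\<^sub>M i\<in>{1..N}. std_complex_gaussian)"
        by measurable
    qed auto
    then have "AE l in distr M (\<Pi>\<^sub>M i\<in>{1..N}. borel) (\<lambda>\<omega>. \<lambda>i\<in>{1..N}. of_real s * lam i \<omega>). eigenvalue_weight N l \<noteq> 0"
      unfolding law .
    moreover have "(\<lambda>\<omega>. \<lambda>i\<in>{1..N}. of_real s * lam i \<omega>) \<in> M \<rightarrow>\<^sub>M (\<Pi>\<^sub>M i\<in>{1..N}. borel)"
      by (intro measurable_restrict borel_measurable_times borel_measurable_const lam)
    moreover have "{l \<in> space (\<Pi>\<^sub>M i\<in>{1..N}. borel). eigenvalue_weight N l \<noteq> 0} \<in> sets (\<Pi>\<^sub>M i\<in>{1..N}. borel)"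
      by measurable
    ultimately have "AE \<omega> in M. eigenvalue_weight N (\<lambda>i\<in>{1..N}. of_real s * lam i \<omega>) \<noteq> 0"
      by (simp only: AE_distr_iff)
    then show ?thesis by (simp only: eigenvalue_weight_scale_eq_0_iff[OF s(2)] weight)
  qed
  have "cond_eq_in_distribution M F E O11 prd" for E
    unfolding cond_eq_in_distribution_def
  proof (intro ballI)
    fix B :: "real set" assume B: "B \<in> sets borel"
    have Bm: "indicat_real B \<in> borel_measurable borel" using B by simp
    have "AE \<omega> in M. real_cond_exp M F (indicat_real (O11 -` B \<inter> space M)) \<omega> =
      enn2real (\<integral>\<^sup>+y. ennreal (indicat_real B (g (L \<omega>, y))) \<partial>(\<Pi>\<^sub>M j\<in>?J. std_complex_gaussian))"
      by (rule condO[OF Bm]) (auto simp: O11 indicator_def)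
    moreover have "AE \<omega> in M. real_cond_exp M F (indicat_real (prd -` B \<inter> space M)) \<omega> =
      enn2real (\<integral>\<^sup>+y. ennreal (indicat_real B (h (L \<omega>, y))) \<partial>(\<Pi>\<^sub>M j\<in>?K. std_complex_gaussian))"
      by (rule condP[OF Bm]) (auto simp: prd indicator_def)
    ultimately show "AE \<omega> in M. \<omega> \<in> E \<longrightarrow> real_cond_exp M F (indicat_real (O11 -` B \<inter> space M)) \<omega> =
        real_cond_exp M F (indicat_real (prd -` B \<inter> space M)) \<omega>"
      using distinct by eventually_elim (simp add: same[OF Bm])
  qed
  moreover have "AE \<omega> in M. real_cond_exp M F O11 \<omega> =
      (\<Prod>k=2..N. 1 + 1 / (2 * real N * (cmod (lam 1 \<omega> - lam k \<omega>))\<^sup>2)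
                          + 1 / (2 * real N * (cmod (lam 1 \<omega> - cnj (lam k \<omega>)))\<^sup>2))"
  proof -
    \<comment> \<open>the identity is no non-negative test function on all reals, its positive part is\<close>
    have posm: "(\<lambda>r. max 0 r) \<in> borel_measurable (borel :: real measure)" by measurable
    have "AE \<omega> in M. real_cond_exp M F O11 \<omega> =
        enn2real (\<integral>\<^sup>+y. ennreal (max 0 (g (L \<omega>, y))) \<partial>(\<Pi>\<^sub>M j\<in>?J. std_complex_gaussian))"
      by (rule condO[OF posm]) (auto simp: O11 g0)
    then show ?thesis using distinct
    proof eventually_elim
      case (elim \<omega>)
      have "real_cond_exp M F O11 \<omega> =
          enn2real (\<integral>\<^sup>+y. ennreal (overlap_product (sc (L \<omega>)) N y) \<partial>(\<Pi>\<^sub>M j\<in>?K. std_complex_gaussian))"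
        unfolding elim(1) same[OF posm elim(2)] by (simp add: h_def overlap_product_nonneg)
      also have "\<dots> = (\<Prod>k=2..N. 1 + 1 / (cmod (sc (L \<omega>) 1 - sc (L \<omega>) k))\<^sup>2 + 1 / (cmod (sc (L \<omega>) 1 - cnj (sc (L \<omega>) k)))\<^sup>2)"
        unfolding nn_integral_overlap_product[OF N] by (intro enn2real_ennreal prod_nonneg) simp
      also have "\<dots> = (\<Prod>k=2..N. 1 + 1 / (2 * real N * (cmod (lam 1 \<omega> - lam k \<omega>))\<^sup>2)
                          + 1 / (2 * real N * (cmod (lam 1 \<omega> - cnj (lam k \<omega>)))\<^sup>2))"
        by (intro prod.cong refl) (simp only: gap)
      finally show ?case .
    qed
  qed
  ultimately show ?thesis unfolding prd_def by blast
qed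

end
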